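(* Let $R$ be a Noetherian local ring and $F=\{J_n\}_{n\ge0}$ a Noetherian filtration of ideals in $R$. Let $\delta$ be the maximum degree of the elements of a minimal homogeneous generating set of the Rees algebra $\Re_F(R)=\bigoplus_{n\ge0}J_n$. Let $I=(f_1,\dots,f_r)$, where $f_1,\dots,f_r$ is a $J_1$-filter regular sequence. Set $a_i=a_{J_1}\big(((f_1,\dots,f_{i-1}):f_i)/(f_1,\dots,f_{i-1})\big)$ for $i=1,\dots,r$, and $$N=\max\{(a_1+2a_2+\cdots+2^{r-1}a_r+1)\delta,\ \operatorname{ar}_F((f_1))+1,\dots,\operatorname{ar}_F((f_1,\dots,f_r))+1\}.$$ Let $f_i'=f_i+\varepsilon_i$ with $\varepsilon_i\in J_N$ arbitrary, $i=1,\dots,r$, and $I'=(f_1',\dots,f_r')$. Then $f_1',\dots,f_r'$ is a $J_1$-filter regular sequence and $\operatorname{in}_F(I')=\operatorname{in}_F(I)$.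
   Context: A filtration $F=\{J_n\}_{n\ge0}$ of ideals satisfies $J_0=R$, $J_m\subseteq J_n$ for $m>n$, and $J_mJ_n\subseteq J_{m+n}$; it is Noetherian if $\Re_F(R)=\bigoplus_n J_n$ is a Noetherian ring. $\operatorname{gr}_F(R)=\bigoplus_n J_n/J_{n+1}$; for $0\ne f\in R$ (then $f\in J_n\setminus J_{n+1}$ for a unique $n$) $f^*$ is the class of $f$ in $J_n/J_{n+1}$, $0^*=0$, and $\operatorname{in}_F(I)$ is the ideal of $\operatorname{gr}_F(R)$ generated by $f^*$, $f\in I$. The Artin–Rees number $\operatorname{ar}_F(I)$ is the maximum degree of the elements of a minimal homogeneous generating set of the ideal $\bigoplus_n(J_n\cap I)$ of $\Re_F(R)$. A sequence $f_1,\dots,f_r$ is $J_1$-filter regular if for each $i$, $f_i\notin\mathfrak p$ for every associated prime $\mathfrak p$ of $R/(f_1,\dots,f_{i-1})$ with $\mathfrak p\not\supseteq J_1$. For an $R$-module $M$, $a_{J_1}(M)=\inf\{n:J_1^nM=0\}$. *)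

theory Defs
  imports "HOL-Computational_Algebra.Polynomial"
begin

definition is_ideal :: "'a::comm_ring_1 set \<Rightarrow> bool" where
  "is_ideal I \<longleftrightarrow> 0 \<in> I \<and> (\<forall>x\<in>I. \<forall>y\<in>I. x + y \<in> I) \<and> (\<forall>r. \<forall>x\<in>I. r * x \<in> I)"

definition gen_ideal :: "'a::comm_ring_1 set \<Rightarrow> 'a set" where
  "gen_ideal S = \<Inter>{I. is_ideal I \<and> S \<subseteq> I}"

definition prime_ideal :: "'a::comm_ring_1 set \<Rightarrow> bool" where
  "prime_ideal P \<longleftrightarrow> is_ideal P \<and> P \<noteq> UNIV \<and> (\<forall>x y. x * y \<in> P \<longrightarrow> x \<in> P \<or> y \<in> P)"

definition maximal_ideal :: "'a::comm_ring_1 set \<Rightarrow> bool" where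
  "maximal_ideal M \<longleftrightarrow> is_ideal M \<and> M \<noteq> UNIV \<and>
     (\<forall>I. is_ideal I \<and> M \<subseteq> I \<longrightarrow> I = M \<or> I = UNIV)"

definition noetherian_ring :: "'a::comm_ring_1 itself \<Rightarrow> bool" where
  "noetherian_ring _ \<longleftrightarrow> (\<forall>I::'a set. is_ideal I \<longrightarrow> (\<exists>G. finite G \<and> I = gen_ideal G))"

definition local_ring :: "'a::comm_ring_1 itself \<Rightarrow> bool" where
  "local_ring _ \<longleftrightarrow> (\<exists>!M::'a set. maximal_ideal M)"

definition ideal_prod :: "'a::comm_ring_1 set \<Rightarrow> 'a set \<Rightarrow> 'a set" where
  "ideal_prod I K = gen_ideal {x * y | x y. x \<in> I \<and> y \<in> K}"

fun ideal_pow :: "'a::comm_ring_1 set \<Rightarrow> nat \<Rightarrow> 'a set" where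
  "ideal_pow I 0 = UNIV"
| "ideal_pow I (Suc n) = ideal_prod I (ideal_pow I n)"

definition colon :: "'a::comm_ring_1 set \<Rightarrow> 'a \<Rightarrow> 'a set" where
  "colon I x = {y. y * x \<in> I}"

definition ass_primes :: "'a::comm_ring_1 set \<Rightarrow> 'a set set" where
  "ass_primes I = {P. prime_ideal P \<and> (\<exists>x. P = colon I x)}"

text \<open>a_K(A/B) = inf{n. K^n (A/B) = 0}, for ideals B \<subseteq> A.\<close>
definition a_index :: "'a::comm_ring_1 set \<Rightarrow> 'a set \<Rightarrow> 'a set \<Rightarrow> nat" where
  "a_index K A B = (LEAST n. \<forall>a\<in>ideal_pow K n. \<forall>y\<in>A. a * y \<in> B)"

definition filter_regular :: "'a::comm_ring_1 set \<Rightarrow> (nat \<Rightarrow> 'a) \<Rightarrow> nat \<Rightarrow> bool" where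
  "filter_regular K f r \<longleftrightarrow>
     (\<forall>i<r. \<forall>P\<in>ass_primes (gen_ideal (f ` {..<i})). \<not> K \<subseteq> P \<longrightarrow> f i \<notin> P)"

definition filtration :: "(nat \<Rightarrow> 'a::comm_ring_1 set) \<Rightarrow> bool" where
  "filtration J \<longleftrightarrow> J 0 = UNIV \<and> (\<forall>n. is_ideal (J n)) \<and> (\<forall>m n. n \<le> m \<longrightarrow> J m \<subseteq> J n)
     \<and> (\<forall>m n. \<forall>x\<in>J m. \<forall>y\<in>J n. x * y \<in> J (m + n))"

definition rees :: "(nat \<Rightarrow> 'a::comm_ring_1 set) \<Rightarrow> 'a poly set" where
  "rees J = {p. \<forall>n. coeff p n \<in> J n}"

definition rees_ideal :: "(nat \<Rightarrow> 'a::comm_ring_1 set) \<Rightarrow> 'a poly set \<Rightarrow> bool" where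
  "rees_ideal J A \<longleftrightarrow> A \<subseteq> rees J \<and> 0 \<in> A \<and> (\<forall>p\<in>A. \<forall>q\<in>A. p + q \<in> A)
     \<and> (\<forall>s\<in>rees J. \<forall>p\<in>A. s * p \<in> A)"

definition rees_gen :: "(nat \<Rightarrow> 'a::comm_ring_1 set) \<Rightarrow> 'a poly set \<Rightarrow> 'a poly set" where
  "rees_gen J G = \<Inter>{A. rees_ideal J A \<and> G \<subseteq> A}"

definition noetherian_rees :: "(nat \<Rightarrow> 'a::comm_ring_1 set) \<Rightarrow> bool" where
  "noetherian_rees J \<longleftrightarrow> (\<forall>A. rees_ideal J A \<longrightarrow> (\<exists>G. finite G \<and> A = rees_gen J G))"

definition alg_gen :: "'a::comm_ring_1 poly set \<Rightarrow> 'a poly set" where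
  "alg_gen G = \<Inter>{S. (\<forall>c. [:c:] \<in> S) \<and> (\<forall>p\<in>S. \<forall>q\<in>S. p + q \<in> S \<and> p * q \<in> S) \<and> G \<subseteq> S}"

definition homogeneous :: "'a::comm_ring_1 poly \<Rightarrow> bool" where
  "homogeneous p \<longleftrightarrow> (\<exists>c n. p = monom c n)"

definition max_gen_deg :: "'a::comm_ring_1 poly set \<Rightarrow> nat" where
  "max_gen_deg G = Max (insert 0 (degree ` G))"

definition min_hom_alg_gen :: "(nat \<Rightarrow> 'a::comm_ring_1 set) \<Rightarrow> 'a poly set \<Rightarrow> bool" where
  "min_hom_alg_gen J G \<longleftrightarrow> G \<subseteq> rees J \<and> (\<forall>g\<in>G. homogeneous g) \<and> alg_gen G = rees J
     \<and> (\<forall>H. H \<subset> G \<longrightarrow> alg_gen H \<noteq> rees J)"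

definition rees_delta :: "(nat \<Rightarrow> 'a::comm_ring_1 set) \<Rightarrow> nat" where
  "rees_delta J = (SOME d. \<exists>G. min_hom_alg_gen J G \<and> d = max_gen_deg G)"

definition min_hom_ideal_gen :: "(nat \<Rightarrow> 'a::comm_ring_1 set) \<Rightarrow> 'a poly set \<Rightarrow> 'a poly set \<Rightarrow> bool" where
  "min_hom_ideal_gen J A G \<longleftrightarrow> G \<subseteq> A \<and> (\<forall>g\<in>G. homogeneous g) \<and> rees_gen J G = A
     \<and> (\<forall>H. H \<subset> G \<longrightarrow> rees_gen J H \<noteq> A)"

definition rees_part :: "(nat \<Rightarrow> 'a::comm_ring_1 set) \<Rightarrow> 'a set \<Rightarrow> 'a poly set" where
  "rees_part J I = {p. \<forall>n. coeff p n \<in> J n \<inter> I}"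

definition ar_num :: "(nat \<Rightarrow> 'a::comm_ring_1 set) \<Rightarrow> 'a set \<Rightarrow> nat" where
  "ar_num J I = (SOME d. \<exists>G. min_hom_ideal_gen J (rees_part J I) G \<and> d = max_gen_deg G)"

text \<open>gr_F(R) is modelled as the quotient Rees(J) / (+)_n J(n+1) t^n; its elements are cosets.\<close>
definition gr_ker :: "(nat \<Rightarrow> 'a::comm_ring_1 set) \<Rightarrow> 'a poly set" where
  "gr_ker J = {p. \<forall>n. coeff p n \<in> J (Suc n)}"

definition gr_class :: "(nat \<Rightarrow> 'a::comm_ring_1 set) \<Rightarrow> 'a poly \<Rightarrow> 'a poly set" where
  "gr_class J p = {p + k | k. k \<in> gr_ker J}"

definition initial_lift :: "(nat \<Rightarrow> 'a::comm_ring_1 set) \<Rightarrow> 'a \<Rightarrow> 'a poly" where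
  "initial_lift J f = (if \<exists>n. f \<in> J n \<and> f \<notin> J (Suc n)
      then monom f (THE n. f \<in> J n \<and> f \<notin> J (Suc n)) else 0)"

definition initial_form :: "(nat \<Rightarrow> 'a::comm_ring_1 set) \<Rightarrow> 'a \<Rightarrow> 'a poly set" where
  "initial_form J f = gr_class J (initial_lift J f)"

text \<open>in_F(I): ideal of gr_F(R) generated by the f^*, f \<in> I (image of the ideal generated by the lifts).\<close>
definition in_F :: "(nat \<Rightarrow> 'a::comm_ring_1 set) \<Rightarrow> 'a set \<Rightarrow> 'a poly set set" where
  "in_F J I = gr_class J ` rees_gen J (initial_lift J ` I)"

end

theory Submission
  imports Defs
begin

text \<open>
  Put \<open>K = J 1\<close> and perturb the \<open>f\<^sub>j\<close> one at a time. Fix \<open>j\<close> and let \<open>Q\<close> be generated by the other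
  elements of an initial segment of the sequence. Filter regularity means that
  \<open>(f\<^sub>1, ..., f\<^sub>i\<^sub>-\<^sub>1) : f\<^sub>i\<close> is carried into \<open>(f\<^sub>1, ..., f\<^sub>i\<^sub>-\<^sub>1)\<close> by a power of \<open>K\<close>; by an exchange argument
  \<open>K\<close> to the power \<open>a\<^sub>j + a\<^sub>j\<^sub>+\<^sub>1 + ...\<close> carries \<open>Q : f\<^sub>j\<close> into \<open>Q\<close>. Hence \<open>\<epsilon>\<^sub>j\<close>, which lies in that power
  because \<open>J N\<close> does, annihilates \<open>(Q : f\<^sub>j)/Q\<close>. In an element \<open>h (f\<^sub>j + \<epsilon>\<^sub>j) + q\<close> of \<open>J n\<close> with \<open>q\<close> in \<open>Q\<close>,
  the Artin--Rees bound then allows one to raise the degree of \<open>h\<close> until \<open>h \<epsilon>\<^sub>j\<close> lies in \<open>J (n + 1)\<close>,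
  so the initial ideals agree; with the intersection theorem the same argument gives
  \<open>Q : (f\<^sub>j + \<epsilon>\<^sub>j) \<subseteq> Q : f\<^sub>j\<close>. Agreement of initial ideals preserves the Artin--Rees bound, and
  Nakayama's lemma shows that the exponents \<open>a\<^sub>i\<close> still work for the new sequence, so the
  perturbations can be iterated.
\<close>

section \<open>Ideals of a commutative ring\<close>

lemma is_ideal_zero: "is_ideal I \<Longrightarrow> 0 \<in> I"
  and is_ideal_add: "is_ideal I \<Longrightarrow> x \<in> I \<Longrightarrow> y \<in> I \<Longrightarrow> x + y \<in> I"
  and is_ideal_mult: "is_ideal I \<Longrightarrow> x \<in> I \<Longrightarrow> r * x \<in> I"
  unfolding is_ideal_def by auto

lemma is_ideal_mult_right: "is_ideal I \<Longrightarrow> x \<in> I \<Longrightarrow> x * r \<in> I"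
  using is_ideal_mult[of I x r] by (simp add: mult.commute)

lemma is_ideal_uminus: "is_ideal I \<Longrightarrow> x \<in> I \<Longrightarrow> - x \<in> I"
  using is_ideal_mult[of I x "- 1"] by simp

lemma is_ideal_diff: "is_ideal I \<Longrightarrow> x \<in> I \<Longrightarrow> y \<in> I \<Longrightarrow> x - y \<in> I"
  using is_ideal_add[of I x "- y"] is_ideal_uminus[of I y] by simp

lemma is_ideal_sum: "is_ideal I \<Longrightarrow> (\<And>i. i \<in> A \<Longrightarrow> g i \<in> I) \<Longrightarrow> sum g A \<in> I"
  by (induction A rule: infinite_finite_induct) (auto intro: is_ideal_zero is_ideal_add)

lemma is_ideal_diff_iff: "is_ideal I \<Longrightarrow> x - y \<in> I \<Longrightarrow> y \<in> I \<longleftrightarrow> x \<in> I"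
  using is_ideal_add[of I "x - y" y] is_ideal_diff[of I x "x - y"] by auto

lemma is_ideal_UNIV [simp]: "is_ideal UNIV"
  by (simp add: is_ideal_def)

lemma is_ideal_gen_ideal [simp]: "is_ideal (gen_ideal S)"
  unfolding is_ideal_def gen_ideal_def by blast

lemma gen_ideal_superset: "S \<subseteq> gen_ideal S"
  unfolding gen_ideal_def by blast

lemma gen_ideal_least: "is_ideal I \<Longrightarrow> S \<subseteq> I \<Longrightarrow> gen_ideal S \<subseteq> I"
  unfolding gen_ideal_def by blast

lemma is_ideal_ideal_prod [simp]: "is_ideal (ideal_prod I K)"
  by (simp add: ideal_prod_def)

lemma ideal_prodI: "x \<in> I \<Longrightarrow> y \<in> K \<Longrightarrow> x * y \<in> ideal_prod I K"
  unfolding ideal_prod_def by (rule subsetD[OF gen_ideal_superset]) blast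

lemma ideal_prod_least:
  "is_ideal L \<Longrightarrow> (\<And>x y. x \<in> I \<Longrightarrow> y \<in> K \<Longrightarrow> x * y \<in> L) \<Longrightarrow> ideal_prod I K \<subseteq> L"
  unfolding ideal_prod_def by (rule gen_ideal_least) auto

lemma is_ideal_ideal_pow [simp]: "is_ideal (ideal_pow K n)"
  by (cases n) auto

lemma is_ideal_colon: "is_ideal I \<Longrightarrow> is_ideal (colon I x)"
  unfolding is_ideal_def colon_def by (auto simp: algebra_simps)

lemma ideal_pow_mult_mem:
  assumes "x \<in> ideal_pow K m" "y \<in> ideal_pow K n"
  shows "x * y \<in> ideal_pow K (m + n)"
proof -
  have "\<forall>x\<in>ideal_pow K m. x * y \<in> ideal_pow K (m + n)"
  proof (induction m)
    case 0
    then show ?case using assms by (auto intro: is_ideal_mult)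
  next
    case (Suc m)
    have "ideal_pow K (Suc m) \<subseteq> colon (ideal_pow K (Suc (m + n))) y"
      unfolding ideal_pow.simps(2)[of K m]
    proof (rule ideal_prod_least)
      fix k z assume "k \<in> K" "z \<in> ideal_pow K m"
      then show "k * z \<in> colon (ideal_pow K (Suc (m + n))) y"
        using Suc by (auto intro!: ideal_prodI simp: colon_def mult.assoc)
    qed (simp add: is_ideal_colon)
    then show ?case by (auto simp: colon_def)
  qed
  with assms show ?thesis by blast
qed

text \<open>Lets membership in a power be tested on products of two factors, although the recursion
  peels off one element at a time. Peeling off \<open>k\<close> replaces \<open>L\<close> by
  \<open>colon L k\<close>, so the induction varies \<open>L\<close>.\<close>

lemma ideal_pow_add_least:
  assumes L: "is_ideal L" and
    prod: "\<And>x y. x \<in> ideal_pow K m \<Longrightarrow> y \<in> ideal_pow K n \<Longrightarrow> x * y \<in> L"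
  shows "ideal_pow K (m + n) \<subseteq> L"
  using assms
proof (induction m arbitrary: L)
  case 0
  then show ?case using "0.prems"(2)[of 1] by auto
next
  case (Suc m)
  have "ideal_pow K (Suc (m + n)) \<subseteq> L"
    unfolding ideal_pow.simps
  proof (rule ideal_prod_least[OF Suc.prems(1)])
    fix k z assume k: "k \<in> K" and z: "z \<in> ideal_pow K (m + n)"
    have "ideal_pow K (m + n) \<subseteq> colon L k"
    proof (rule Suc.IH)
      fix x y assume "x \<in> ideal_pow K m" "y \<in> ideal_pow K n"
      then have "(k * x) * y \<in> L"
        using Suc.prems(2)[of "k * x" y] k by (auto intro: ideal_prodI)
      then show "x * y \<in> colon L k" by (simp add: colon_def ac_simps)
    qed (rule is_ideal_colon[OF Suc.prems(1)])
    then show "k * z \<in> L" using z by (auto simp: colon_def mult.commute)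
  qed
  then show ?case by simp
qed

lemma ideal_pow_anti_Suc: "ideal_pow K (Suc n) \<subseteq> ideal_pow K n"
  unfolding ideal_pow.simps by (rule ideal_prod_least) (auto intro: is_ideal_mult)

lemma ideal_pow_anti: "m \<le> n \<Longrightarrow> ideal_pow K n \<subseteq> ideal_pow K m"
  by (induction rule: dec_induct) (use ideal_pow_anti_Suc in blast)+

lemma ideal_pow_one: "x \<in> K \<Longrightarrow> x \<in> ideal_pow K (Suc 0)"
  using ideal_prodI[of x K 1 UNIV] by simp

section \<open>Adjoining an element and adding ideals\<close>

definition adjoin :: "'a::comm_ring_1 set \<Rightarrow> 'a \<Rightarrow> 'a set" where
  "adjoin Q f = {x. \<exists>h. x - h * f \<in> Q}"

lemma adjoinI: "x - h * f \<in> Q \<Longrightarrow> x \<in> adjoin Q f"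
  unfolding adjoin_def by blast

lemma adjoinE:
  assumes "x \<in> adjoin Q f" obtains h where "x - h * f \<in> Q"
  using assms unfolding adjoin_def by blast

text \<open>One closure argument for \<open>Q + H f\<close>: \<open>H = UNIV\<close> gives
  \<open>adjoin\<close>, \<open>f = 1\<close> gives \<open>ideal_sum\<close>, and a smaller
  \<open>H\<close> records where the coefficient of \<open>f\<close> lies.\<close>

lemma is_ideal_adjoin_coeff:
  assumes Q: "is_ideal Q" and H: "is_ideal H"
  shows "is_ideal {x. \<exists>h\<in>H. x - h * f \<in> Q}"
  unfolding is_ideal_def
proof (intro conjI ballI allI)
  show "0 \<in> {x. \<exists>h\<in>H. x - h * f \<in> Q}"
    using is_ideal_zero[OF Q] is_ideal_zero[OF H] by (auto intro!: bexI[of _ 0])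
next
  fix x y assume "x \<in> {x. \<exists>h\<in>H. x - h * f \<in> Q}" "y \<in> {x. \<exists>h\<in>H. x - h * f \<in> Q}"
  then obtain h k where "h \<in> H" "x - h * f \<in> Q" "k \<in> H" "y - k * f \<in> Q" by blast
  then show "x + y \<in> {x. \<exists>h\<in>H. x - h * f \<in> Q}"
    using is_ideal_add[OF Q, of "x - h * f" "y - k * f"] is_ideal_add[OF H, of h k]
    by (auto intro!: bexI[of _ "h + k"] simp: algebra_simps)
next
  fix r x assume "x \<in> {x. \<exists>h\<in>H. x - h * f \<in> Q}"
  then obtain h where "h \<in> H" "x - h * f \<in> Q" by blast
  then show "r * x \<in> {x. \<exists>h\<in>H. x - h * f \<in> Q}"
    using is_ideal_mult[OF Q, of "x - h * f" r] is_ideal_mult[OF H, of h r]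
    by (auto intro!: bexI[of _ "r * h"] simp: algebra_simps)
qed

lemma is_ideal_adjoin: "is_ideal Q \<Longrightarrow> is_ideal (adjoin Q f)"
  using is_ideal_adjoin_coeff[of Q UNIV f] by (simp add: adjoin_def)

lemma adjoin_superset: "Q \<subseteq> adjoin Q f"
  by (auto intro: adjoinI[where h = 0])

lemma adjoin_self: "is_ideal Q \<Longrightarrow> h * f \<in> adjoin Q f"
  by (rule adjoinI[where h = h]) (simp add: is_ideal_zero)

lemma gen_ideal_insert: "gen_ideal (insert f S) = adjoin (gen_ideal S) f"
proof
  show "gen_ideal (insert f S) \<subseteq> adjoin (gen_ideal S) f"
    using gen_ideal_superset[of S] adjoin_superset[of "gen_ideal S" f]
      adjoin_self[of "gen_ideal S" 1 f]
    by (intro gen_ideal_least is_ideal_adjoin) auto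
  show "adjoin (gen_ideal S) f \<subseteq> gen_ideal (insert f S)"
  proof
    fix x assume "x \<in> adjoin (gen_ideal S) f"
    then obtain h where h: "x - h * f \<in> gen_ideal S" by (rule adjoinE)
    have "gen_ideal S \<subseteq> gen_ideal (insert f S)"
      using gen_ideal_superset[of "insert f S"] by (intro gen_ideal_least) auto
    moreover have "h * f \<in> gen_ideal (insert f S)"
      using gen_ideal_superset[of "insert f S"] by (intro is_ideal_mult) auto
    ultimately have "(x - h * f) + h * f \<in> gen_ideal (insert f S)"
      using h by (intro is_ideal_add) auto
    then show "x \<in> gen_ideal (insert f S)" by simp
  qed
qed

definition ideal_sum :: "'a::comm_ring_1 set \<Rightarrow> 'a set \<Rightarrow> 'a set" where
  "ideal_sum I L = {x. \<exists>y\<in>I. x - y \<in> L}"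

lemma ideal_sumI: "y \<in> I \<Longrightarrow> x - y \<in> L \<Longrightarrow> x \<in> ideal_sum I L"
  unfolding ideal_sum_def by blast

lemma ideal_sumE:
  assumes "x \<in> ideal_sum I L" obtains y where "y \<in> I" "x - y \<in> L"
  using assms unfolding ideal_sum_def by blast

lemma is_ideal_ideal_sum: "is_ideal I \<Longrightarrow> is_ideal L \<Longrightarrow> is_ideal (ideal_sum I L)"
  using is_ideal_adjoin_coeff[of L I 1] by (simp add: ideal_sum_def)

lemma ideal_sum_left: "is_ideal L \<Longrightarrow> x \<in> I \<Longrightarrow> x \<in> ideal_sum I L"
  by (rule ideal_sumI[of x]) (auto simp: is_ideal_zero)

lemma ideal_sum_right: "is_ideal I \<Longrightarrow> x \<in> L \<Longrightarrow> x \<in> ideal_sum I L"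
  by (rule ideal_sumI[of 0]) (auto simp: is_ideal_zero)

section \<open>Noetherian local rings\<close>

text \<open>The union of a chain of ideals is finitely generated and its generators already lie in
  one member, so Zorn's lemma applies.\<close>

lemma noetherian_maximal_element:
  fixes \<F> :: "'a::comm_ring_1 set set"
  assumes noeth: "noetherian_ring TYPE('a)"
    and ne: "\<F> \<noteq> {}" and ideals: "\<And>I. I \<in> \<F> \<Longrightarrow> is_ideal I"
  obtains M where "M \<in> \<F>" "\<And>X. X \<in> \<F> \<Longrightarrow> M \<subseteq> X \<Longrightarrow> X = M"
proof -
  have "\<exists>M\<in>\<F>. \<forall>X\<in>\<F>. M \<subseteq> X \<longrightarrow> X = M"
  proof (rule subset_Zorn_nonempty[OF ne])
    fix \<C> assume ne: "\<C> \<noteq> {}" and chain: "subset.chain \<F> \<C>"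
    have sub: "\<C> \<subseteq> \<F>" and total: "\<And>X Y. X \<in> \<C> \<Longrightarrow> Y \<in> \<C> \<Longrightarrow> X \<subseteq> Y \<or> Y \<subseteq> X"
      using chain by (auto simp: subset_chain_def)
    have id: "is_ideal X" if "X \<in> \<C>" for X using that sub ideals by blast
    have "is_ideal (\<Union>\<C>)"
      unfolding is_ideal_def
    proof (intro conjI ballI allI)
      show "0 \<in> \<Union>\<C>" using ne id is_ideal_zero by blast
    next
      fix x y assume "x \<in> \<Union>\<C>" "y \<in> \<Union>\<C>"
      then obtain X Y where "X \<in> \<C>" "x \<in> X" "Y \<in> \<C>" "y \<in> Y" by blast
      with total[of X Y] show "x + y \<in> \<Union>\<C>" using id is_ideal_add by blast
    next
      fix r x assume "x \<in> \<Union>\<C>"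
      then show "r * x \<in> \<Union>\<C>" using id is_ideal_mult by blast
    qed
    then obtain G where G: "finite G" "\<Union>\<C> = gen_ideal G"
      using noeth unfolding noetherian_ring_def by blast
    have "\<exists>X\<in>\<C>. G \<subseteq> X"
      using finite_subset_Union_chain[of G \<C> \<F>] G gen_ideal_superset[of G] ne chain by metis
    then obtain X where X: "X \<in> \<C>" "G \<subseteq> X" by blast
    then have "\<Union>\<C> \<subseteq> X" using gen_ideal_least id G(2) by blast
    with X have "\<Union>\<C> = X" by blast
    then show "\<Union>\<C> \<in> \<F>" using X sub by blast
  qed
  with that show ?thesis by blast
qed

text \<open>Otherwise \<open>1 - k\<close> lies in a maximal ideal. By uniqueness this is also the
  one above \<open>K\<close>, so it contains \<open>k\<close> and therefore 1.\<close>

lemma local_ring_one_minus_unit: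
  fixes K :: "'a::comm_ring_1 set"
  assumes noeth: "noetherian_ring TYPE('a)" and loc: "local_ring TYPE('a)"
    and K: "is_ideal K" "K \<noteq> UNIV" and k: "k \<in> K"
  obtains v where "v * (1 - k) = 1"
proof -
  have maxex: "\<exists>M. maximal_ideal M \<and> I \<subseteq> M" if I: "is_ideal I" "I \<noteq> UNIV" for I :: "'a set"
  proof -
    let ?F = "{M. is_ideal M \<and> M \<noteq> UNIV \<and> I \<subseteq> M}"
    obtain M where "M \<in> ?F" and max: "\<And>X. X \<in> ?F \<Longrightarrow> M \<subseteq> X \<Longrightarrow> X = M"
      by (rule noetherian_maximal_element[OF noeth, of ?F]) (use I in auto)
    then have "maximal_ideal M" unfolding maximal_ideal_def by blast
    then show ?thesis using \<open>M \<in> ?F\<close> by blast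
  qed
  let ?I = "{x. \<exists>h. x = h * (1 - k)}"
  have "?I = UNIV"
  proof (rule ccontr)
    assume "?I \<noteq> UNIV"
    moreover have "is_ideal ?I"
      using is_ideal_adjoin[of "{0}" "1 - k"] by (simp add: adjoin_def is_ideal_def)
    ultimately obtain M where M: "maximal_ideal M" "?I \<subseteq> M" using maxex by meson
    obtain M' where M': "maximal_ideal M'" "K \<subseteq> M'" using maxex K by meson
    have "M' = M" using loc M(1) M'(1) unfolding local_ring_def by blast
    then have "k \<in> M" using M' k by blast
    moreover have "1 - k \<in> M" using M(2) by (auto intro!: exI[of _ 1])
    moreover have idM: "is_ideal M" using M(1) by (simp add: maximal_ideal_def)
    ultimately have "1 \<in> M" using is_ideal_add[of M k "1 - k"] by simp
    then have "M = UNIV" using is_ideal_mult_right[OF idM] by fastforce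
    then show False using M(1) by (simp add: maximal_ideal_def)
  qed
  then have "1 \<in> ?I" by blast
  with that show ?thesis by auto
qed

text \<open>Noetherian induction replaces a choice of generators of \<open>V\<close>. If
  \<open>M\<close> is maximal among the ideals that contain \<open>L\<close> but not
  \<open>V\<close>, and \<open>w\<close> in \<open>V\<close> lies outside \<open>M\<close>, then
  \<open>V \<subseteq> M + R w\<close>; the hypothesis gives \<open>(1 - k) w \<in> M\<close> with
  \<open>1 - k\<close> a unit.\<close>

lemma nakayama:
  fixes K :: "'a::comm_ring_1 set"
  assumes noeth: "noetherian_ring TYPE('a)" and loc: "local_ring TYPE('a)"
    and K: "is_ideal K" "K \<noteq> UNIV" and V: "is_ideal V" and L: "is_ideal L"
    and sub: "V \<subseteq> ideal_sum L (ideal_prod K V)"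
  shows "V \<subseteq> L"
proof (rule ccontr)
  assume "\<not> V \<subseteq> L"
  let ?F = "{M. is_ideal M \<and> L \<subseteq> M \<and> \<not> V \<subseteq> M}"
  obtain M where "M \<in> ?F" and max: "\<And>X. X \<in> ?F \<Longrightarrow> M \<subseteq> X \<Longrightarrow> X = M"
    by (rule noetherian_maximal_element[OF noeth, of ?F]) (use \<open>\<not> V \<subseteq> L\<close> L in auto)
  then have M: "is_ideal M" "L \<subseteq> M" "\<not> V \<subseteq> M" by auto
  obtain w where w: "w \<in> V" "w \<notin> M" using M(3) by blast
  have "adjoin M w \<noteq> M"
    using adjoin_self[OF M(1), of 1 w] w by auto
  then have VM: "V \<subseteq> adjoin M w"
    using max[of "adjoin M w"] adjoin_superset[of M w] is_ideal_adjoin[OF M(1), of w] M(2) by blast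
  let ?B = "{x. \<exists>k\<in>K. x - k * w \<in> M}"
  have B: "is_ideal ?B" by (rule is_ideal_adjoin_coeff[OF M(1) K(1)])
  have "ideal_prod K V \<subseteq> ?B"
  proof (rule ideal_prod_least[OF B])
    fix k v assume k: "k \<in> K" and "v \<in> V"
    then obtain h where "v - h * w \<in> M" using VM by (blast elim: adjoinE)
    then have "k * v - (k * h) * w \<in> M"
      using is_ideal_mult[OF M(1), of "v - h * w" k] by (simp add: algebra_simps)
    moreover have "k * h \<in> K" using is_ideal_mult_right[OF K(1) k] .
    ultimately show "k * v \<in> ?B" by blast
  qed
  moreover obtain y where y: "y \<in> L" "w - y \<in> ideal_prod K V"
    using w(1) sub by (blast elim: ideal_sumE)
  ultimately obtain k where k: "k \<in> K" "w - y - k * w \<in> M" by blast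
  have "y + (w - y - k * w) \<in> M" using y k M by (blast intro: is_ideal_add)
  then have "(1 - k) * w \<in> M" by (simp add: algebra_simps)
  moreover obtain v where v: "v * (1 - k) = 1"
    using local_ring_one_minus_unit[OF noeth loc K k(1)] .
  ultimately have "v * ((1 - k) * w) \<in> M" using is_ideal_mult[OF M(1)] by blast
  moreover have "v * ((1 - k) * w) = w" using v by (simp flip: mult.assoc)
  ultimately show False using w(2) by simp
qed

section \<open>Filter regularity and annihilating powers\<close>

text \<open>The property whose least exponent is \<open>a_index\<close>; arbitrary exponents are
  allowed so that upper bounds can be transported.\<close>

definition kills :: "'a::comm_ring_1 set \<Rightarrow> nat \<Rightarrow> 'a set \<Rightarrow> 'a set \<Rightarrow> bool" where
  "kills K n A B \<longleftrightarrow> (\<forall>a\<in>ideal_pow K n. \<forall>y\<in>A. a * y \<in> B)"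

lemma killsD: "kills K n A B \<Longrightarrow> a \<in> ideal_pow K n \<Longrightarrow> y \<in> A \<Longrightarrow> a * y \<in> B"
  unfolding kills_def by blast

lemma kills_mono: "kills K n A B \<Longrightarrow> A' \<subseteq> A \<Longrightarrow> kills K n A' B"
  unfolding kills_def by blast

text \<open>With \<open>P = colon I z\<close>, the assumption on \<open>x\<close> says that
  \<open>z\<close> lies in \<open>colon I x\<close>. So a power of \<open>K\<close> carries
  \<open>z\<close> into \<open>I\<close>, that is, lies in \<open>P\<close>, and \<open>P\<close> is
  prime.\<close>

lemma ass_prime_superset_of_kills:
  assumes P: "P \<in> ass_primes I" and kill: "kills K n (colon I x) I" and "x \<in> P"
  shows "K \<subseteq> P"
proof -
  obtain z where z: "P = colon I z" and prime: "prime_ideal P"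
    using P unfolding ass_primes_def by blast
  have idP: "is_ideal P" using prime by (simp add: prime_ideal_def)
  have "z \<in> colon I x" using \<open>x \<in> P\<close> z by (simp add: colon_def mult.commute)
  then have sub: "ideal_pow K n \<subseteq> P"
    using kill z by (auto simp: kills_def colon_def)
  show ?thesis
  proof
    fix k assume k: "k \<in> K"
    have "k ^ n \<in> ideal_pow K n"
      by (induction n) (use k in \<open>auto intro: ideal_prodI\<close>)
    then have "k ^ n \<in> P" using sub by blast
    then show "k \<in> P"
    proof (induction n)
      case 0
      then show ?case using is_ideal_mult_right[OF idP, of 1] by simp
    next
      case (Suc n)
      then show ?case using prime by (auto simp: prime_ideal_def)
    qed
  qed
qed

text \<open>The ascending ideals \<open>I : K^n\<close> stabilise at some \<open>T n\<close>. Among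
  the elements of \<open>I : x\<close> outside \<open>T n\<close>, one with maximal annihilator
  modulo \<open>I\<close> would have an associated prime as annihilator. This prime contains
  \<open>x\<close>, hence \<open>K\<close>, which would put the element into
  \<open>T n\<close>.\<close>

lemma kills_colon_of_ass_primes:
  fixes K :: "'a::comm_ring_1 set"
  assumes noeth: "noetherian_ring TYPE('a)" and I: "is_ideal I" and K: "is_ideal K"
    and reg: "\<And>P. P \<in> ass_primes I \<Longrightarrow> \<not> K \<subseteq> P \<Longrightarrow> x \<notin> P"
  shows "\<exists>n. kills K n (colon I x) I"
proof -
  define T where "T n = {y. \<forall>a\<in>ideal_pow K n. a * y \<in> I}" for n
  have T: "is_ideal (T n)" for n
    unfolding is_ideal_def T_def
    using I by (auto simp: is_ideal_def algebra_simps)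
  have T_mono: "T m \<subseteq> T n" if "m \<le> n" for m n
    using ideal_pow_anti[OF that, of K] by (auto simp: T_def)
  obtain M where M: "M \<in> range T" and max: "\<And>X. X \<in> range T \<Longrightarrow> M \<subseteq> X \<Longrightarrow> X = M"
    by (rule noetherian_maximal_element[OF noeth, of "range T"]) (use T in auto)
  then obtain n where n: "M = T n" by blast
  have T_le: "T m \<subseteq> T n" for m
    using max[of "T (max m n)"] T_mono[of n "max m n"] T_mono[of m "max m n"] n by auto
  have IT: "I \<subseteq> T n" using is_ideal_mult[OF I] by (auto simp: T_def)
  have "colon I x \<subseteq> T n"
  proof (rule ccontr)
    assume "\<not> colon I x \<subseteq> T n"
    let ?F = "{colon I w | w. w \<in> colon I x \<and> w \<notin> T n}"
    obtain P where "P \<in> ?F" and max: "\<And>X. X \<in> ?F \<Longrightarrow> P \<subseteq> X \<Longrightarrow> X = P"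
      by (rule noetherian_maximal_element[OF noeth, of ?F])
        (use \<open>\<not> colon I x \<subseteq> T n\<close> is_ideal_colon[OF I] in auto)
    then obtain w where P: "P = colon I w" and w: "w \<in> colon I x" "w \<notin> T n" by blast
    \<comment> \<open>By maximality, multiples of \<open>w\<close> outside \<open>T n\<close> keep
      the annihilator \<open>P\<close>; primality is read off from this.\<close>
    have stable: "colon I (a * w) = P" if "a * w \<notin> T n" for a
    proof (rule max)
      show "colon I (a * w) \<in> ?F"
        using that is_ideal_mult[OF is_ideal_colon[OF I] w(1)] by blast
      show "P \<subseteq> colon I (a * w)"
        using is_ideal_mult[OF I] by (auto simp: P colon_def mult.left_commute[of _ a w])
    qed
    have idP: "is_ideal P" using P is_ideal_colon[OF I] by simp
    have "w \<notin> I" using w IT by blast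
    then have "1 \<notin> P" by (simp add: P colon_def)
    \<comment> \<open>Otherwise \<open>w\<close> would lie in \<open>T (n + n)\<close>, which is
      contained in the stable \<open>T n\<close>.\<close>
    obtain k where k: "k \<in> ideal_pow K n" "k * w \<notin> T n"
    proof -
      have "\<exists>k\<in>ideal_pow K n. k * w \<notin> T n"
      proof (rule ccontr)
        assume "\<not> (\<exists>k\<in>ideal_pow K n. k * w \<notin> T n)"
        then have "ideal_pow K (n + n) \<subseteq> colon I w"
          by (intro ideal_pow_add_least is_ideal_colon[OF I])
            (auto simp: colon_def T_def mult.assoc)
        then have "w \<in> T (n + n)" by (auto simp: T_def colon_def)
        then show False using T_le w by blast
      qed
      then show ?thesis using that by blast
    qed
    have "prime_ideal P"
      unfolding prime_ideal_def
    proof (intro conjI allI impI)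
      show "P \<noteq> UNIV" using \<open>1 \<notin> P\<close> by blast
      fix a b assume ab: "a * b \<in> P"
      show "a \<in> P \<or> b \<in> P"
      proof (cases "a * w \<in> T n")
        case True
        then have "k * (a * w) \<in> I" using k by (simp add: T_def)
        then have "a \<in> colon I (k * w)" by (simp add: colon_def ac_simps)
        then show ?thesis using stable[OF k(2)] by simp
      next
        case False
        have "b \<in> colon I (a * w)" using ab by (simp add: P colon_def ac_simps)
        then show ?thesis using stable[OF False] by simp
      qed
    qed (rule idP)
    then have "P \<in> ass_primes I" using P by (auto simp: ass_primes_def)
    moreover have "x \<in> P" using w(1) by (simp add: P colon_def mult.commute)
    ultimately have "K \<subseteq> P" using reg by blast
    then have "ideal_pow K (Suc 0) \<subseteq> P"
      using ideal_prod_least[OF idP, of K UNIV] is_ideal_mult_right[OF idP] by auto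
    then have "w \<in> T (Suc 0)" unfolding P T_def colon_def by blast
    then show False using T_le w by blast
  qed
  then have "kills K n (colon I x) I" by (auto simp: kills_def T_def)
  then show ?thesis ..
qed

lemma filter_regular_iff_kills:
  fixes K :: "'a::comm_ring_1 set"
  assumes noeth: "noetherian_ring TYPE('a)" and K: "is_ideal K"
  shows "filter_regular K f r \<longleftrightarrow>
    (\<forall>i<r. \<exists>n. kills K n (colon (gen_ideal (f ` {..<i})) (f i)) (gen_ideal (f ` {..<i})))"
  unfolding filter_regular_def
  using kills_colon_of_ass_primes[OF noeth is_ideal_gen_ideal K] ass_prime_superset_of_kills
  by meson

lemma kills_a_index: "kills K n A B \<Longrightarrow> kills K (a_index K A B) A B"
  unfolding kills_def a_index_def by (rule LeastI)

section \<open>Perturbing one element\<close>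

text \<open>The exchange argument. If \<open>s f \<equiv> t g\<close> modulo \<open>Q\<close>, then
  \<open>u\<close> from the power \<open>a\<close> gives \<open>u t \<equiv> v f\<close>, so
  \<open>(u s - v g) f \<in> Q\<close>, and a factor from the power \<open>c\<close> carries
  \<open>u s - v g\<close> into \<open>Q\<close>.\<close>

lemma kills_colon_swap:
  assumes Q: "is_ideal Q" and c: "kills K c (colon Q f) Q"
    and a: "kills K a (colon (adjoin Q f) g) (adjoin Q f)"
  shows "kills K (c + a) (colon (adjoin Q g) f) (adjoin Q g)"
  unfolding kills_def
proof (intro ballI)
  fix b s assume b: "b \<in> ideal_pow K (c + a)" and "s \<in> colon (adjoin Q g) f"
  then obtain t where t: "s * f - t * g \<in> Q" by (auto simp: colon_def elim: adjoinE)
  have "t \<in> colon (adjoin Q f) g"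
    using is_ideal_uminus[OF Q t] by (auto simp: colon_def intro: adjoinI[where h = s])
  have "ideal_pow K (c + a) \<subseteq> colon (adjoin Q g) s"
  proof (rule ideal_pow_add_least)
    fix e u assume e: "e \<in> ideal_pow K c" and u: "u \<in> ideal_pow K a"
    then obtain v where v: "u * t - v * f \<in> Q"
      using killsD[OF a _ \<open>t \<in> colon (adjoin Q f) g\<close>] by (blast elim: adjoinE)
    have "u * (s * f - t * g) + g * (u * t - v * f) \<in> Q"
      using t v Q by (intro is_ideal_add is_ideal_mult)
    then have "u * s - v * g \<in> colon Q f" by (simp add: colon_def algebra_simps)
    then have "e * (u * s - v * g) \<in> Q" using killsD[OF c e] by blast
    then show "e * u \<in> colon (adjoin Q g) s"
      by (auto simp: colon_def algebra_simps intro!: adjoinI[where h = "e * v"])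
  qed (intro is_ideal_colon is_ideal_adjoin Q)
  then show "b * s \<in> adjoin Q g" using b by (auto simp: colon_def)
qed

text \<open>Writing \<open>M\<close> for the new colon ideal and \<open>L\<close> for the new base ideal, one shows
  \<open>K\<^sup>a M \<subseteq> L + K\<^sup>a\<^sup>+\<^sup>1 M\<close> and concludes by Nakayama: a relation \<open>z g \<equiv> w (f + \<epsilon>)\<close> is compared
  with a relation \<open>y g \<equiv> w f\<close>, and the difference is controlled because \<open>\<epsilon>\<close> is a sum of
  products \<open>e e'\<close> with \<open>e \<in> K\<^sup>a\<^sup>+\<^sup>1\<close> and \<open>e'\<close> killing the torsion.\<close>

lemma kills_colon_perturb_base:
  fixes K :: "'a::comm_ring_1 set"
  assumes noeth: "noetherian_ring TYPE('a)" and loc: "local_ring TYPE('a)"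
    and K: "is_ideal K" "K \<noteq> UNIV" and Q: "is_ideal Q"
    and c: "kills K c (colon Q f) Q"
    and a: "kills K a (colon (adjoin Q f) g) (adjoin Q f)"
    and colon_sub: "colon (adjoin Q g) (f + \<epsilon>) \<subseteq> colon (adjoin Q g) f"
    and \<epsilon>: "\<epsilon> \<in> ideal_pow K (Suc a + (c + a))"
  shows "kills K a (colon (adjoin Q (f + \<epsilon>)) g) (adjoin Q (f + \<epsilon>))"
proof -
  define L where "L = adjoin Q (f + \<epsilon>)"
  define M where "M = colon L g"
  define V where "V = ideal_prod (ideal_pow K a) M"
  define Z where "Z = ideal_prod K V"
  define Y where "Y = ideal_prod (ideal_pow K (Suc a)) (colon Q g)"
  have L: "is_ideal L" unfolding L_def by (rule is_ideal_adjoin[OF Q])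
  have M: "is_ideal M" unfolding M_def by (rule is_ideal_colon[OF L])
  have Z: "is_ideal Z" and Y: "is_ideal Y" by (simp_all add: Z_def Y_def)
  have QL: "Q \<subseteq> L" unfolding L_def by (rule adjoin_superset)
  have QgM: "colon Q g \<subseteq> M" using QL by (auto simp: M_def colon_def)
  have KZ: "e * y \<in> Z" if "e \<in> ideal_pow K (Suc a)" "y \<in> M" for e y
  proof -
    have "ideal_pow K (Suc a) \<subseteq> colon Z y"
      unfolding ideal_pow.simps
    proof (rule ideal_prod_least)
      fix k x assume "k \<in> K" "x \<in> ideal_pow K a"
      then have "k * (x * y) \<in> Z" using \<open>y \<in> M\<close> by (simp add: Z_def V_def ideal_prodI)
      then show "k * x \<in> colon Z y" by (simp add: colon_def mult.assoc)
    qed (rule is_ideal_colon[OF Z])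
    then show ?thesis using that by (auto simp: colon_def)
  qed
  have YZ: "Y \<subseteq> Z"
    unfolding Y_def using KZ QgM by (intro ideal_prod_least Z) blast
  have LZ: "is_ideal (ideal_sum L Z)" by (rule is_ideal_ideal_sum[OF L Z])
  have LsubLZ: "x \<in> ideal_sum L Z" if "x \<in> L" for x using ideal_sum_left[OF Z that] .
  have ZsubLZ: "x \<in> ideal_sum L Z" if "x \<in> Z" for x using ideal_sum_right[OF L that] .
  have split_f: "t * f + t * \<epsilon> \<in> L" for t
    using adjoin_self[OF Q, of t "f + \<epsilon>"] by (simp add: L_def distrib_left)

  \<comment> \<open>The torsion case. From \<open>u z \<equiv> t f\<close> follows
    \<open>t g \<in> Q : f\<close>, so the factors \<open>e'\<close> of \<open>\<epsilon>\<close>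
    carry \<open>t\<close> into \<open>Q : g\<close> and the factors \<open>e\<close> bring
    \<open>t \<epsilon>\<close> into \<open>Z\<close>, while
    \<open>t (f + \<epsilon>) \<in> L\<close>.\<close>
  have tors: "u * z \<in> ideal_sum L Z" if u: "u \<in> ideal_pow K a" and z: "z \<in> colon Q g" for u z
  proof -
    have "z \<in> colon (adjoin Q f) g" using z adjoin_superset by (auto simp: colon_def)
    then obtain t where t: "u * z - t * f \<in> Q"
      using killsD[OF a u] by (blast elim: adjoinE)
    have "u * (z * g) - g * (u * z - t * f) \<in> Q"
      using z t Q by (auto simp: colon_def intro!: is_ideal_diff is_ideal_mult)
    then have tg: "t * g \<in> colon Q f" by (simp add: colon_def algebra_simps)
    have "ideal_pow K (Suc a + (c + a)) \<subseteq> colon Y t"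
    proof (rule ideal_pow_add_least)
      fix e e' assume e: "e \<in> ideal_pow K (Suc a)" and "e' \<in> ideal_pow K (c + a)"
      then have "e' \<in> ideal_pow K c" using ideal_pow_anti[of c "c + a" K] by auto
      then have "e' * (t * g) \<in> Q" using killsD[OF c _ tg] by blast
      then have "e' * t \<in> colon Q g" by (simp add: colon_def mult.assoc)
      then have "e * (e' * t) \<in> Y" using e by (simp add: Y_def ideal_prodI)
      then show "e * e' \<in> colon Y t" by (simp add: colon_def mult.assoc)
    qed (rule is_ideal_colon[OF Y])
    then have "t * \<epsilon> \<in> Z" using \<epsilon> YZ by (auto simp: colon_def mult.commute)
    then have "(u * z - t * f) + (t * f + t * \<epsilon>) - t * \<epsilon> \<in> ideal_sum L Z"
      using t QL split_f by (intro is_ideal_add[OF LZ] is_ideal_diff[OF LZ] LsubLZ ZsubLZ) auto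
    then show ?thesis by simp
  qed

  have "u * z \<in> ideal_sum L Z" if u: "u \<in> ideal_pow K a" and "z \<in> M" for u z
  proof -
    obtain w where w: "z * g - w * (f + \<epsilon>) \<in> Q"
      using \<open>z \<in> M\<close> by (auto simp: M_def L_def colon_def elim: adjoinE)
    have "w \<in> colon (adjoin Q g) (f + \<epsilon>)"
      using is_ideal_uminus[OF Q w] by (auto simp: colon_def intro: adjoinI[where h = z])
    then have wf: "w \<in> colon (adjoin Q g) f" using colon_sub by blast
    then obtain y where y: "w * f - y * g \<in> Q" by (auto simp: colon_def elim: adjoinE)
    have "y \<in> colon (adjoin Q f) g"
      using is_ideal_uminus[OF Q y] by (auto simp: colon_def intro: adjoinI[where h = w])
    then obtain t where t: "u * y - t * f \<in> Q"
      using killsD[OF a u] by (blast elim: adjoinE)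
    have "g * (u * y - t * f) + u * (w * f - y * g) \<in> Q"
      using t y Q by (intro is_ideal_add is_ideal_mult)
    then have uwtg: "u * w - t * g \<in> colon Q f" by (simp add: colon_def algebra_simps)

    \<comment> \<open>The ideal on the right consists of the \<open>x\<close> for which
      \<open>x w\<close> is a multiple \<open>q g\<close> modulo \<open>Q\<close> with
      \<open>u q \<equiv> t x\<close> modulo \<open>Y\<close>. The exchange lemma supplies
      \<open>q\<close> for \<open>e'\<close>, and the factor \<open>e\<close> brings the discrepancy
      into \<open>Y\<close>.\<close>
    have "ideal_pow K (Suc a + (c + a)) \<subseteq> {x. \<exists>q. x * w - q * g \<in> Q \<and> u * q - t * x \<in> Y}"
      (is "_ \<subseteq> ?E")
    proof (rule ideal_pow_add_least)
      show "is_ideal ?E"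
        unfolding is_ideal_def
      proof (intro conjI ballI allI)
        show "0 \<in> ?E" using is_ideal_zero[OF Q] is_ideal_zero[OF Y]
          by (auto intro!: exI[of _ 0])
      next
        fix x x' assume "x \<in> ?E" "x' \<in> ?E"
        then obtain q q' where q: "x * w - q * g \<in> Q" "u * q - t * x \<in> Y"
          "x' * w - q' * g \<in> Q" "u * q' - t * x' \<in> Y" by blast
        have "(x + x') * w - (q + q') * g \<in> Q" "u * (q + q') - t * (x + x') \<in> Y"
          using is_ideal_add[OF Q q(1,3)] is_ideal_add[OF Y q(2,4)]
          by (simp_all add: algebra_simps)
        then show "x + x' \<in> ?E" by blast
      next
        fix r x assume "x \<in> ?E"
        then obtain q where q: "x * w - q * g \<in> Q" "u * q - t * x \<in> Y" by blast
        have "(r * x) * w - (r * q) * g \<in> Q" "u * (r * q) - t * (r * x) \<in> Y"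
          using is_ideal_mult[OF Q q(1), of r] is_ideal_mult[OF Y q(2), of r]
          by (simp_all add: algebra_simps)
        then show "r * x \<in> ?E" by blast
      qed
    next
      fix e e' assume e: "e \<in> ideal_pow K (Suc a)" and e': "e' \<in> ideal_pow K (c + a)"
      obtain q where q: "e' * w - q * g \<in> Q"
        using killsD[OF kills_colon_swap[OF Q c a] e' wf] by (blast elim: adjoinE)
      have "e' \<in> ideal_pow K c" using e' ideal_pow_anti[of c "c + a" K] by auto
      then have "e' * (u * w - t * g) \<in> Q" using killsD[OF c _ uwtg] by blast
      then have "e' * (u * w - t * g) - u * (e' * w - q * g) \<in> Q"
        using is_ideal_diff[OF Q _ is_ideal_mult[OF Q q, of u]] by blast
      then have "u * q - t * e' \<in> colon Q g" by (simp add: colon_def algebra_simps)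
      then have "e * (u * q - t * e') \<in> Y" using e by (simp add: Y_def ideal_prodI)
      then have "u * (e * q) - t * (e * e') \<in> Y" by (simp add: algebra_simps)
      moreover have "(e * e') * w - (e * q) * g \<in> Q"
        using is_ideal_mult[OF Q q, of e] by (simp add: algebra_simps)
      ultimately show "e * e' \<in> ?E" by blast
    qed
    then obtain q where q: "\<epsilon> * w - q * g \<in> Q" "u * q - t * \<epsilon> \<in> Y" using \<epsilon> by blast
    \<comment> \<open>The sum telescopes to \<open>(z - y - q) g\<close>, which reduces the general
      case to the torsion case.\<close>
    have "(z * g - w * (f + \<epsilon>)) + (w * f - y * g) + (\<epsilon> * w - q * g) \<in> Q"
      using w y q Q by (intro is_ideal_add)
    then have "z - y - q \<in> colon Q g" by (simp add: colon_def algebra_simps)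
    then have "u * (z - y - q) \<in> ideal_sum L Z" by (rule tors[OF u])
    then have "u * (z - y - q) + (u * y - t * f) + (t * f + t * \<epsilon>) + (u * q - t * \<epsilon>)
        \<in> ideal_sum L Z"
      by (intro is_ideal_add[OF LZ is_ideal_add[OF LZ is_ideal_add[OF LZ _ LsubLZ] LsubLZ] ZsubLZ])
        (use t QL q(2) YZ split_f in auto)
    then show ?thesis by (simp add: algebra_simps)
  qed
  then have "V \<subseteq> ideal_sum L Z"
    unfolding V_def by (intro ideal_prod_least LZ)
  then have "V \<subseteq> L"
    unfolding Z_def by (intro nakayama[OF noeth loc K _ L]) (simp add: V_def)
  then have "kills K a M L" by (auto simp: kills_def V_def dest: ideal_prodI)
  then show ?thesis by (simp add: M_def L_def)
qed

section \<open>Artin--Rees bounds\<close>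

text \<open>The degree \<open>n\<close> part of the Rees ideal generated by the components of
  \<open>rees_part J I\<close> in degrees at most \<open>c\<close>.\<close>

definition ar_span :: "(nat \<Rightarrow> 'a::comm_ring_1 set) \<Rightarrow> 'a set \<Rightarrow> nat \<Rightarrow> nat \<Rightarrow> 'a set" where
  "ar_span J I c n = gen_ideal {x * y | x y d. d \<le> c \<and> d \<le> n \<and> x \<in> J (n - d) \<and> y \<in> J d \<and> y \<in> I}"

definition ar_bound :: "(nat \<Rightarrow> 'a::comm_ring_1 set) \<Rightarrow> 'a set \<Rightarrow> nat \<Rightarrow> bool" where
  "ar_bound J I c \<longleftrightarrow> (\<forall>n. J n \<inter> I \<subseteq> ar_span J I c n)"

lemma is_ideal_ar_span [simp]: "is_ideal (ar_span J I c n)"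
  by (simp add: ar_span_def)

lemma ar_spanI:
  "d \<le> c \<Longrightarrow> d \<le> n \<Longrightarrow> x \<in> J (n - d) \<Longrightarrow> y \<in> J d \<Longrightarrow> y \<in> I \<Longrightarrow> x * y \<in> ar_span J I c n"
  unfolding ar_span_def by (rule subsetD[OF gen_ideal_superset]) blast

lemma ar_span_least:
  assumes "is_ideal L"
    and "\<And>x y d. d \<le> c \<Longrightarrow> d \<le> n \<Longrightarrow> x \<in> J (n - d) \<Longrightarrow> y \<in> J d \<Longrightarrow> y \<in> I \<Longrightarrow> x * y \<in> L"
  shows "ar_span J I c n \<subseteq> L"
  unfolding ar_span_def by (rule gen_ideal_least) (use assms in auto)

lemma ar_bound_mono: "ar_bound J I c \<Longrightarrow> c \<le> c' \<Longrightarrow> ar_bound J I c'"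
  using ar_span_least[OF is_ideal_ar_span, of c _ J I J I c'] ar_spanI[of _ c' _ _ J _ I]
  unfolding ar_bound_def by (meson order_trans)

text \<open>The inclusion of initial ideals \<open>in(I) \<subseteq> in(I')\<close>, without reference to the graded ring.\<close>

definition initially_below :: "(nat \<Rightarrow> 'a::comm_ring_1 set) \<Rightarrow> 'a set \<Rightarrow> 'a set \<Rightarrow> bool" where
  "initially_below J I I' \<longleftrightarrow> (\<forall>n. J n \<inter> I \<subseteq> ideal_sum I' (J (Suc n)))"

lemma initially_belowE:
  assumes "initially_below J I I'" "x \<in> J n" "x \<in> I"
  obtains y where "y \<in> I'" "x - y \<in> J (Suc n)"
  using assms unfolding initially_below_def by (blast elim: ideal_sumE)

locale ideal_filtration =
  fixes J :: "nat \<Rightarrow> 'a::comm_ring_1 set"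
  assumes filtration: "filtration J"
begin

lemma J_zero [simp]: "J 0 = UNIV"
  and is_ideal_J [simp]: "is_ideal (J n)"
  and J_mult: "x \<in> J m \<Longrightarrow> y \<in> J n \<Longrightarrow> x * y \<in> J (m + n)"
  using filtration by (auto simp: filtration_def)

lemma J_anti: "n \<le> m \<Longrightarrow> J m \<subseteq> J n"
  using filtration unfolding filtration_def by blast

lemma J_mult_diff: "x \<in> J (n - d) \<Longrightarrow> y \<in> J m \<Longrightarrow> k + d \<le> n + m \<Longrightarrow> d \<le> n \<Longrightarrow> x * y \<in> J k"
  by (rule subsetD[OF J_anti J_mult]) auto

lemma ar_span_anti:
  assumes I: "is_ideal I" and "n \<le> m"
  shows "ar_span J I c m \<subseteq> ar_span J I c n"
proof (rule ar_span_least)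
  fix x y d assume d: "d \<le> c" "d \<le> m" and x: "x \<in> J (m - d)" and y: "y \<in> J d" "y \<in> I"
  show "x * y \<in> ar_span J I c n"
  proof (cases "d \<le> n")
    case True
    then show ?thesis using x y d J_anti[OF diff_le_mono[OF \<open>n \<le> m\<close>], of d] by (intro ar_spanI[of d]) auto
  next
    case False
    then show ?thesis using y d J_anti[of n d] by (intro ar_spanI[of n]) auto
  qed
qed simp

lemma ar_span_initially_below:
  assumes I': "is_ideal I'" and below: "initially_below J I I'"
  shows "ar_span J I c n \<subseteq> ideal_sum (ar_span J I' c n) (J (Suc n))"
proof (rule ar_span_least)
  show "is_ideal (ideal_sum (ar_span J I' c n) (J (Suc n)))"
    by (simp add: is_ideal_ideal_sum)
  fix x y d assume d: "d \<le> c" "d \<le> n" and x: "x \<in> J (n - d)" and y: "y \<in> J d" "y \<in> I"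
  obtain y' where y': "y' \<in> I'" "y - y' \<in> J (Suc d)" using initially_belowE[OF below y] .
  have "y - y' \<in> J d" using y' J_anti[of d "Suc d"] by auto
  then have "y' \<in> J d" using is_ideal_diff_iff[OF is_ideal_J] y(1) by blast
  then have "x * y' \<in> ar_span J I' c n" using d x y' by (intro ar_spanI[of d]) auto
  moreover have "x * y - x * y' \<in> J (Suc n)"
    using J_mult_diff[OF x y'(2), of "Suc n"] d by (simp add: right_diff_distrib)
  ultimately show "x * y \<in> ideal_sum (ar_span J I' c n) (J (Suc n))" by (rule ideal_sumI)
qed

text \<open>Passing to \<open>I\<close> and back approximates an element of \<open>I'\<close> from
  \<open>ar_span J I' c\<close>, with an error one degree deeper. Any finite bound \<open>c'\<close>
  for \<open>I'\<close> ends the iteration.\<close>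

lemma ar_bound_transfer:
  assumes I': "is_ideal I'" and bound: "ar_bound J I c"
    and below: "initially_below J I I'" "initially_below J I' I"
    and bound': "ar_bound J I' c'"
  shows "ar_bound J I' c"
  unfolding ar_bound_def
proof (intro allI subsetI)
  fix n x assume x: "x \<in> J n \<inter> I'"
  have in_I': "ar_span J I' c n \<subseteq> I'" for n
    by (rule ar_span_least[OF I']) (rule is_ideal_mult[OF I'])
  have step: "\<exists>y\<in>ar_span J I' c p. x - y \<in> J (Suc p)" if xp: "x \<in> J p" "x \<in> I'" for x p
  proof -
    obtain y where y: "y \<in> I" "x - y \<in> J (Suc p)" using initially_belowE[OF below(2) xp] .
    have "x - y \<in> J p" using y J_anti[of p "Suc p"] by auto
    then have "y \<in> J p" using is_ideal_diff_iff[OF is_ideal_J] xp(1) by blast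
    then have "y \<in> ar_span J I c p" using y bound by (auto simp: ar_bound_def)
    then obtain z where z: "z \<in> ar_span J I' c p" "y - z \<in> J (Suc p)"
      using ar_span_initially_below[OF I' below(1)] by (blast elim: ideal_sumE)
    then have "(x - y) + (y - z) \<in> J (Suc p)" using y by (intro is_ideal_add) auto
    then show ?thesis using z by auto
  qed
  have iter: "\<exists>y\<in>ar_span J I' c n. x - y \<in> J (n + t) \<and> x - y \<in> I'" for t
  proof (induction t)
    case 0
    then show ?case using x by (intro bexI[of _ 0]) (auto intro: is_ideal_zero)
  next
    case (Suc t)
    then obtain y where y: "y \<in> ar_span J I' c n" "x - y \<in> J (n + t)" "x - y \<in> I'" by blast
    obtain z where z: "z \<in> ar_span J I' c (n + t)" "x - y - z \<in> J (Suc (n + t))"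
      using step[OF y(2,3)] by blast
    have "z \<in> ar_span J I' c n" using z ar_span_anti[OF I', of n "n + t"] by auto
    then have "y + z \<in> ar_span J I' c n" using y by (intro is_ideal_add) auto
    moreover have "x - (y + z) \<in> I'"
      using is_ideal_diff[OF I' y(3), of z] z in_I' by (auto simp: algebra_simps)
    moreover have "x - (y + z) \<in> J (n + Suc t)" using z by (simp add: algebra_simps)
    ultimately show ?case by blast
  qed
  \<comment> \<open>After \<open>c'\<close> steps the coefficients of the error lie in
    \<open>J (n + c' - d)\<close> with \<open>d \<le> c'\<close>, hence in \<open>J n\<close>, and
    its generators may be counted in degree 0.\<close>
  obtain y where y: "y \<in> ar_span J I' c n" "x - y \<in> J (n + c')" "x - y \<in> I'"
    using iter[of c'] by blast
  have "x - y \<in> ar_span J I' c' (n + c')" using y bound' by (auto simp: ar_bound_def)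
  moreover have "ar_span J I' c' (n + c') \<subseteq> ar_span J I' c n"
  proof (rule ar_span_least)
    fix u v d assume "d \<le> c'" "u \<in> J (n + c' - d)" "v \<in> I'"
    moreover have "J (n + c' - d) \<subseteq> J n" using \<open>d \<le> c'\<close> by (intro J_anti) simp
    ultimately show "u * v \<in> ar_span J I' c n" by (intro ar_spanI[of 0]) auto
  qed simp
  ultimately have "y + (x - y) \<in> ar_span J I' c n" using y by (intro is_ideal_add) auto
  then show "x \<in> ar_span J I' c n" by simp
qed


section \<open>Homogeneous ideals of the Rees algebra and initial ideals\<close>

lemma rees_ideal_graded:
  assumes "\<And>n. is_ideal (B n)" "\<And>n. B n \<subseteq> J n"
    and "\<And>m n x y. x \<in> J m \<Longrightarrow> y \<in> B n \<Longrightarrow> x * y \<in> B (m + n)"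
  shows "rees_ideal J {p. \<forall>n. coeff p n \<in> B n}"
  unfolding rees_ideal_def
proof (intro conjI ballI)
  fix s p assume s: "s \<in> rees J" and p: "p \<in> {p. \<forall>n. coeff p n \<in> B n}"
  have "coeff s i * coeff p (n - i) \<in> B n" if "i \<le> n" for i n
    using s p that assms(3)[of "coeff s i" i "coeff p (n - i)" "n - i"] by (auto simp: rees_def)
  then show "s * p \<in> {p. \<forall>n. coeff p n \<in> B n}"
    by (auto simp: coeff_mult intro!: is_ideal_sum[OF assms(1)])
next
  show "{p. \<forall>n. coeff p n \<in> B n} \<subseteq> rees J" using assms(2) by (auto simp: rees_def)
qed (use assms(1) in \<open>auto intro: is_ideal_zero is_ideal_add\<close>)

lemma rees_ideal_rees: "rees_ideal J (rees J)"
  unfolding rees_def by (rule rees_ideal_graded) (auto intro: J_mult)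

lemma rees_ideal_rees_part: "is_ideal I \<Longrightarrow> rees_ideal J (rees_part J I)"
  unfolding rees_part_def
proof (rule rees_ideal_graded)
  show "is_ideal I \<Longrightarrow> is_ideal (J n \<inter> I)" for n
    using is_ideal_J[of n] unfolding is_ideal_def by blast
qed (auto intro: J_mult is_ideal_mult)

lemma rees_ideal_gr_ker: "rees_ideal J (gr_ker J)"
  unfolding gr_ker_def
proof (rule rees_ideal_graded)
  show "J (Suc n) \<subseteq> J n" for n by (rule J_anti) simp
  show "x * y \<in> J (Suc (m + n))" if "x \<in> J m" "y \<in> J (Suc n)" for m n x y
    using J_mult[OF that] by simp
qed simp

lemma rees_ideal_subset: "rees_ideal J A \<Longrightarrow> p \<in> A \<Longrightarrow> p \<in> rees J"
  and rees_ideal_zero: "rees_ideal J A \<Longrightarrow> 0 \<in> A"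
  and rees_ideal_add: "rees_ideal J A \<Longrightarrow> p \<in> A \<Longrightarrow> q \<in> A \<Longrightarrow> p + q \<in> A"
  and rees_ideal_mult: "rees_ideal J A \<Longrightarrow> s \<in> rees J \<Longrightarrow> p \<in> A \<Longrightarrow> s * p \<in> A"
  unfolding rees_ideal_def by auto

lemma rees_gen_superset: "G \<subseteq> rees_gen J G"
  unfolding rees_gen_def by blast

lemma rees_gen_least: "rees_ideal J A \<Longrightarrow> G \<subseteq> A \<Longrightarrow> rees_gen J G \<subseteq> A"
  unfolding rees_gen_def by blast

lemma rees_ideal_rees_gen:
  assumes "G \<subseteq> rees J"
  shows "rees_ideal J (rees_gen J G)"
  unfolding rees_ideal_def[of J "rees_gen J G"]
proof (intro conjI ballI)
  show "rees_gen J G \<subseteq> rees J" by (rule rees_gen_least[OF rees_ideal_rees assms])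
qed (auto simp: rees_gen_def intro: rees_ideal_zero rees_ideal_add rees_ideal_mult)

lemma rees_gen_idem: "G \<subseteq> rees_gen J H \<Longrightarrow> rees_gen J G \<subseteq> rees_gen J H"
  unfolding rees_gen_def by blast

lemma rees_ideal_sum: "rees_ideal J A \<Longrightarrow> (\<And>i. i \<in> S \<Longrightarrow> g i \<in> A) \<Longrightarrow> sum g S \<in> A"
  by (induction S rule: infinite_finite_induct) (auto simp: rees_ideal_def)

lemma rees_gen_finitary:
  assumes G: "G \<subseteq> rees J" and p: "p \<in> rees_gen J G"
  shows "\<exists>H. finite H \<and> H \<subseteq> G \<and> p \<in> rees_gen J H"
proof -
  let ?U = "{p. \<exists>H. finite H \<and> H \<subseteq> G \<and> p \<in> rees_gen J H}"
  have gen: "rees_ideal J (rees_gen J H)" if "H \<subseteq> G" for H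
    using that G by (intro rees_ideal_rees_gen) auto
  have "rees_ideal J ?U"
    unfolding rees_ideal_def
  proof (intro conjI ballI)
    show "?U \<subseteq> rees J" using rees_ideal_subset[OF gen] by blast
    show "0 \<in> ?U" using rees_ideal_zero[OF gen[of "{}"]] by (auto intro!: exI[of _ "{}"])
  next
    fix p q assume "p \<in> ?U" "q \<in> ?U"
    then obtain H H' where H: "finite H" "H \<subseteq> G" "p \<in> rees_gen J H"
      "finite H'" "H' \<subseteq> G" "q \<in> rees_gen J H'" by blast
    then have "p \<in> rees_gen J (H \<union> H')" "q \<in> rees_gen J (H \<union> H')"
      using rees_gen_idem[of H "H \<union> H'"] rees_gen_idem[of H' "H \<union> H'"]
        rees_gen_superset[of "H \<union> H'"] by blast+
    then have "p + q \<in> rees_gen J (H \<union> H')"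
      using H by (intro rees_ideal_add[OF gen]) auto
    then show "p + q \<in> ?U" using H by blast
  next
    fix s p assume s: "s \<in> rees J" and "p \<in> ?U"
    then obtain H where H: "finite H" "H \<subseteq> G" "p \<in> rees_gen J H" by blast
    then have "s * p \<in> rees_gen J H" using s by (intro rees_ideal_mult[OF gen])
    then show "s * p \<in> ?U" using H by blast
  qed
  moreover have "G \<subseteq> ?U"
  proof
    fix g assume "g \<in> G"
    then show "g \<in> ?U" using rees_gen_superset[of "{g}"] by (auto intro!: exI[of _ "{g}"])
  qed
  ultimately show ?thesis using rees_gen_least[of ?U G] p by blast
qed

text \<open>The polynomials with \<open>n\<close>-th coefficient in \<open>ar_span J I c n\<close>
  form a Rees ideal containing the generators, hence all of \<open>rees_part J I\<close>; monomials
  then give the bound in each degree.\<close>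

lemma ar_bound_of_generators:
  assumes I: "is_ideal I" and G: "rees_gen J G = rees_part J I"
    and hom: "\<And>g. g \<in> G \<Longrightarrow> homogeneous g" and deg: "\<And>g. g \<in> G \<Longrightarrow> degree g \<le> c"
  shows "ar_bound J I c"
proof -
  let ?A = "{p. \<forall>n. coeff p n \<in> ar_span J I c n}"
  have "rees_ideal J ?A"
  proof (rule rees_ideal_graded)
    show "ar_span J I c n \<subseteq> J n" for n
      by (rule ar_span_least) (auto intro: J_mult_diff)
    show "x * y \<in> ar_span J I c (m + n)" if x: "x \<in> J m" and y: "y \<in> ar_span J I c n" for m n x y
    proof -
      have "ar_span J I c n \<subseteq> colon (ar_span J I c (m + n)) x"
      proof (rule ar_span_least)
        fix u v d assume d: "d \<le> c" "d \<le> n" and u: "u \<in> J (n - d)" and v: "v \<in> J d" "v \<in> I"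
        have "(x * u) * v \<in> ar_span J I c (m + n)"
          using d v J_mult[OF x u] by (intro ar_spanI[of d]) auto
        then show "u * v \<in> colon (ar_span J I c (m + n)) x" by (simp add: colon_def ac_simps)
      qed (simp add: is_ideal_colon)
      then show ?thesis using y by (auto simp: colon_def mult.commute)
    qed
  qed simp
  moreover have "G \<subseteq> ?A"
  proof
    fix g assume g: "g \<in> G"
    then obtain x d where gd: "g = monom x d" using hom unfolding homogeneous_def by blast
    have "g \<in> rees_part J I" using g G rees_gen_superset by blast
    then have x: "x \<in> J d" "x \<in> I" using gd by (auto simp: rees_part_def dest: spec[of _ d])
    have "x \<in> ar_span J I c d"
    \<comment> \<open>The polynomial \<open>monom 0 d\<close> has degree 0, so for
      \<open>x = 0\<close> the degree bound says nothing about \<open>d\<close>.\<close>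
    proof (cases "x = 0")
      case False
      then have "1 * x \<in> ar_span J I c d"
        using x deg[OF g] by (intro ar_spanI[of d]) (auto simp: gd degree_monom_eq)
      then show ?thesis by simp
    qed (simp add: is_ideal_zero)
    then show "g \<in> ?A" by (auto simp: gd is_ideal_zero)
  qed
  ultimately have "rees_part J I \<subseteq> ?A" using G rees_gen_least by blast
  moreover have "monom x n \<in> rees_part J I" if "x \<in> J n" "x \<in> I" for x n
    using that I by (auto simp: rees_part_def is_ideal_zero)
  ultimately have "coeff (monom x n) n \<in> ar_span J I c n" if "x \<in> J n" "x \<in> I" for x n
    using that by blast
  then show ?thesis by (auto simp: ar_bound_def)
qed

text \<open>The polynomials congruent modulo \<open>gr_ker J\<close> to an element of the ideal
  generated by the lifts from \<open>I'\<close> form a Rees ideal. It contains the lifts from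
  \<open>I\<close>, since an approximation of \<open>x\<close> up to one degree deeper has the same
  order and initial form.\<close>

lemma in_F_mono:
  assumes below: "initially_below J I I'"
  shows "in_F J I \<subseteq> in_F J I'"
proof -
  let ?R = "rees_gen J (initial_lift J ` I')"
  let ?U = "{p \<in> rees J. \<exists>q\<in>?R. p - q \<in> gr_ker J}"
  have "(THE n. x \<in> J n \<and> x \<notin> J (Suc n)) = n" if "x \<in> J n" "x \<notin> J (Suc n)" for x n
  proof (rule the_equality)
    fix k assume k: "x \<in> J k \<and> x \<notin> J (Suc k)"
    have "\<not> Suc k \<le> n" "\<not> Suc n \<le> k" using k that J_anti by blast+
    then show "k = n" by simp
  qed (use that in auto)
  then have lift: "initial_lift J x = monom x n" if "x \<in> J n" "x \<notin> J (Suc n)" for x n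
    using that unfolding initial_lift_def by auto
  have lift_rees: "initial_lift J x \<in> rees J" for x
  proof (cases "\<exists>n. x \<in> J n \<and> x \<notin> J (Suc n)")
    case True
    then obtain n where "x \<in> J n" "x \<notin> J (Suc n)" by blast
    then show ?thesis using lift by (auto simp: rees_def is_ideal_zero)
  next
    case False
    then show ?thesis unfolding initial_lift_def if_not_P[OF False]
      by (auto simp: rees_def is_ideal_zero)
  qed
  have R: "rees_ideal J ?R" using lift_rees by (intro rees_ideal_rees_gen) auto
  have "rees_ideal J ?U"
    unfolding rees_ideal_def
  proof (intro conjI ballI)
    show "0 \<in> ?U" using R rees_ideal_rees rees_ideal_gr_ker
      by (auto intro: rees_ideal_zero intro!: bexI[of _ 0])
  next
    fix p q assume "p \<in> ?U" "q \<in> ?U"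
    then obtain p' q' where p: "p \<in> rees J" "q \<in> rees J" "p' \<in> ?R" "q' \<in> ?R"
      "p - p' \<in> gr_ker J" "q - q' \<in> gr_ker J" by blast
    have "(p - p') + (q - q') \<in> gr_ker J" "p + q \<in> rees J" "p' + q' \<in> ?R"
      using p R rees_ideal_rees rees_ideal_gr_ker by (auto intro!: rees_ideal_add)
    then show "p + q \<in> ?U" by (auto simp: algebra_simps intro!: bexI[of _ "p' + q'"])
  next
    fix s p assume s: "s \<in> rees J" and "p \<in> ?U"
    then obtain p' where p: "p \<in> rees J" "p' \<in> ?R" "p - p' \<in> gr_ker J" by blast
    have "s * (p - p') \<in> gr_ker J" "s * p \<in> rees J" "s * p' \<in> ?R"
      using s p R rees_ideal_rees rees_ideal_gr_ker by (auto intro!: rees_ideal_mult)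
    then show "s * p \<in> ?U" by (auto simp: algebra_simps intro!: bexI[of _ "s * p'"])
  qed auto
  moreover have "initial_lift J ` I \<subseteq> ?U"
  proof
    fix p assume "p \<in> initial_lift J ` I"
    then obtain x where x: "x \<in> I" "p = initial_lift J x" by blast
    have "\<exists>q\<in>?R. p - q \<in> gr_ker J"
    proof (cases "\<exists>n. x \<in> J n \<and> x \<notin> J (Suc n)")
      case True
      then obtain n where n: "x \<in> J n" "x \<notin> J (Suc n)" by blast
      obtain y where y: "y \<in> I'" "x - y \<in> J (Suc n)" using initially_belowE[OF below n(1) x(1)] .
      have "x - y \<in> J n" using y J_anti[of n "Suc n"] by auto
      then have "y \<in> J n" using is_ideal_diff_iff[OF is_ideal_J] n(1) by blast
      moreover have "y \<notin> J (Suc n)" using is_ideal_diff_iff[OF is_ideal_J y(2)] n(2) by blast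
      ultimately have "initial_lift J y = monom y n" by (rule lift)
      then have "monom y n \<in> ?R" using y(1) rees_gen_superset by (metis image_eqI subsetD)
      moreover have "p - monom y n \<in> gr_ker J"
        using y(2) by (auto simp: x lift[OF n] gr_ker_def diff_monom is_ideal_zero)
      ultimately show ?thesis by blast
    next
      case False
      then have "p = 0" unfolding x initial_lift_def by (rule if_not_P)
      then show ?thesis using R rees_ideal_gr_ker by (auto intro: rees_ideal_zero intro!: bexI[of _ 0])
    qed
    then show "p \<in> ?U" using lift_rees x by blast
  qed
  ultimately have U: "rees_gen J (initial_lift J ` I) \<subseteq> ?U" by (rule rees_gen_least)
  have class_eq: "gr_class J p = gr_class J q" if "p - q \<in> gr_ker J" for p q
  proof -
    have "gr_class J p \<subseteq> gr_class J q" if "p - q \<in> gr_ker J" for p q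
    proof
      fix x assume "x \<in> gr_class J p"
      then obtain k where k: "k \<in> gr_ker J" "x = p + k" unfolding gr_class_def by blast
      have "(p - q) + k \<in> gr_ker J" by (rule rees_ideal_add[OF rees_ideal_gr_ker that k(1)])
      moreover have "x = q + ((p - q) + k)" using k by simp
      ultimately show "x \<in> gr_class J q" unfolding gr_class_def by blast
    qed
    moreover have "q - p \<in> gr_ker J"
      using that is_ideal_uminus[OF is_ideal_J] unfolding gr_ker_def by fastforce
    ultimately show ?thesis using that by blast
  qed
  show ?thesis
  proof
    fix X assume "X \<in> in_F J I"
    then obtain p where p: "p \<in> rees_gen J (initial_lift J ` I)" "X = gr_class J p"
      unfolding in_F_def by blast
    then obtain q where "q \<in> ?R" "p - q \<in> gr_ker J" using U by blast
    then show "X \<in> in_F J I'" unfolding in_F_def p(2) using class_eq by blast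
  qed
qed


text \<open>Each generator is the sum of its homogeneous components, and \<open>closed\<close> keeps
  these components inside the ideal.\<close>

lemma rees_gen_homogeneous_generators:
  assumes G: "finite G" "G \<subseteq> rees J" and closed: "\<And>g n. g \<in> G \<Longrightarrow> monom (coeff g n) n \<in> rees_gen J G"
  obtains H where "finite H" "\<And>h. h \<in> H \<Longrightarrow> homogeneous h" "H \<subseteq> rees J"
    "rees_gen J H = rees_gen J G"
proof
  let ?H = "\<Union>g\<in>G. (\<lambda>n. monom (coeff g n) n) ` {..degree g}"
  show "finite ?H" using G by simp
  show "homogeneous h" if "h \<in> ?H" for h using that unfolding homogeneous_def by blast
  show H: "?H \<subseteq> rees J" using G by (auto simp: rees_def is_ideal_zero)
  have "g \<in> rees_gen J ?H" if "g \<in> G" for g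
  proof -
    have "(\<Sum>n\<le>degree g. monom (coeff g n) n) \<in> rees_gen J ?H"
      using that rees_gen_superset[of ?H] by (intro rees_ideal_sum rees_ideal_rees_gen H) blast
    then show ?thesis by (simp add: poly_as_sum_of_monoms)
  qed
  then show "rees_gen J ?H = rees_gen J G"
    using closed by (intro equalityI rees_gen_idem) auto
qed

end

section \<open>Minimal homogeneous generating sets\<close>

text \<open>Provides the existence behind the \<open>SOME\<close> in \<open>ar_num\<close> and
  \<open>rees_delta\<close>: a generating subset of least cardinality is minimal.\<close>

lemma minimal_generating_subset:
  assumes "finite F" and "cl F = A"
  obtains G where "G \<subseteq> F" "cl G = A" "\<And>H. H \<subset> G \<Longrightarrow> cl H \<noteq> A"
proof -
  obtain G where G: "G \<subseteq> F \<and> cl G = A" and min: "\<And>H. H \<subseteq> F \<and> cl H = A \<Longrightarrow> card G \<le> card H"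
    using ex_has_least_nat[of "\<lambda>G. G \<subseteq> F \<and> cl G = A" F card] assms by blast
  have "cl H \<noteq> A" if "H \<subset> G" for H
    using psubset_card_mono[OF _ that] min[of H] that G finite_subset[OF _ assms(1)]
    by (metis leD psubset_imp_subset subset_trans)
  with G that show ?thesis by blast
qed

text \<open>\<open>SOME\<close> picks an unspecified minimal generating set, whose maximal degree is
  a usable bound once the set is finite. The elements of \<open>F\<close> involve finitely many
  elements of \<open>G\<close>; these already generate, so by minimality they exhaust
  \<open>G\<close>. The abstract \<open>cl\<close> covers Rees ideals and subalgebras alike.\<close>

lemma finite_minimal_generating_set:
  assumes superset: "\<And>G. G \<subseteq> cl G" and idem: "\<And>G H. G \<subseteq> cl H \<Longrightarrow> cl G \<subseteq> cl H"
    and finitary: "\<And>p. p \<in> cl G \<Longrightarrow> \<exists>H. finite H \<and> H \<subseteq> G \<and> p \<in> cl H"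
    and F: "finite F" "cl F = cl G" and minimal: "\<And>H. H \<subset> G \<Longrightarrow> cl H \<noteq> cl G"
  shows "finite G"
proof -
  have "\<forall>p\<in>F. \<exists>H. finite H \<and> H \<subseteq> G \<and> p \<in> cl H"
    using finitary superset[of F] F by blast
  then obtain S where S: "\<And>p. p \<in> F \<Longrightarrow> finite (S p) \<and> S p \<subseteq> G \<and> p \<in> cl (S p)" by metis
  let ?H = "\<Union>p\<in>F. S p"
  have "F \<subseteq> cl ?H"
  proof
    fix p assume p: "p \<in> F"
    have "S p \<subseteq> cl ?H" using superset[of ?H] p by blast
    then show "p \<in> cl ?H" using S[OF p] idem by blast
  qed
  then have "cl G \<subseteq> cl ?H" using idem F by blast
  moreover have "cl ?H \<subseteq> cl G" using S superset[of G] by (intro idem) blast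
  ultimately have "?H = G" using minimal[of ?H] S by blast
  then show ?thesis using S F by blast
qed

lemma degree_le_max_gen_deg: "finite G \<Longrightarrow> g \<in> G \<Longrightarrow> degree g \<le> max_gen_deg G"
  unfolding max_gen_deg_def by (intro Max_ge) auto

section \<open>Subalgebras of the polynomial ring\<close>

definition subalgebra :: "'a::comm_ring_1 poly set \<Rightarrow> bool" where
  "subalgebra S \<longleftrightarrow> (\<forall>c. [:c:] \<in> S) \<and> (\<forall>p\<in>S. \<forall>q\<in>S. p + q \<in> S \<and> p * q \<in> S)"

lemma alg_gen_eq: "alg_gen G = \<Inter>{S. subalgebra S \<and> G \<subseteq> S}"
  unfolding alg_gen_def subalgebra_def by (simp add: conj_assoc)

lemma subalgebra_const: "subalgebra S \<Longrightarrow> [:c:] \<in> S"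
  and subalgebra_add: "subalgebra S \<Longrightarrow> p \<in> S \<Longrightarrow> q \<in> S \<Longrightarrow> p + q \<in> S"
  and subalgebra_mult: "subalgebra S \<Longrightarrow> p \<in> S \<Longrightarrow> q \<in> S \<Longrightarrow> p * q \<in> S"
  unfolding subalgebra_def by auto

lemma subalgebra_sum: "subalgebra S \<Longrightarrow> (\<And>i. i \<in> A \<Longrightarrow> g i \<in> S) \<Longrightarrow> sum g A \<in> S"
  by (induction A rule: infinite_finite_induct)
    (auto intro: subalgebra_add subalgebra_const[of S 0, simplified])

lemma subalgebra_alg_gen: "subalgebra (alg_gen G)"
  unfolding alg_gen_eq subalgebra_def by auto

lemma alg_gen_superset: "G \<subseteq> alg_gen G"
  unfolding alg_gen_eq by blast

lemma alg_gen_least: "subalgebra S \<Longrightarrow> G \<subseteq> S \<Longrightarrow> alg_gen G \<subseteq> S"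
  unfolding alg_gen_eq by blast

lemma alg_gen_idem: "G \<subseteq> alg_gen H \<Longrightarrow> alg_gen G \<subseteq> alg_gen H"
  by (rule alg_gen_least[OF subalgebra_alg_gen])

lemma alg_gen_finitary:
  assumes "p \<in> alg_gen G"
  shows "\<exists>H. finite H \<and> H \<subseteq> G \<and> p \<in> alg_gen H"
proof -
  let ?U = "{p. \<exists>H. finite H \<and> H \<subseteq> G \<and> p \<in> alg_gen H}"
  have "subalgebra ?U"
    unfolding subalgebra_def
  proof (intro conjI ballI allI)
    fix c show "[:c:] \<in> ?U" using subalgebra_const[OF subalgebra_alg_gen, of c "{}"] by blast
  next
    fix p q assume "p \<in> ?U" "q \<in> ?U"
    then obtain H H' where H: "finite H" "H \<subseteq> G" "p \<in> alg_gen H"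
      "finite H'" "H' \<subseteq> G" "q \<in> alg_gen H'" by blast
    then have pq: "p \<in> alg_gen (H \<union> H')" "q \<in> alg_gen (H \<union> H')"
      using alg_gen_idem[of H "H \<union> H'"] alg_gen_idem[of H' "H \<union> H'"]
        alg_gen_superset[of "H \<union> H'"] by blast+
    have "p + q \<in> alg_gen (H \<union> H')" "p * q \<in> alg_gen (H \<union> H')"
      using subalgebra_add[OF subalgebra_alg_gen pq] subalgebra_mult[OF subalgebra_alg_gen pq] .
    moreover have "finite (H \<union> H')" "H \<union> H' \<subseteq> G" using H by auto
    ultimately show "p + q \<in> ?U" "p * q \<in> ?U" by blast+
  qed
  moreover have "G \<subseteq> ?U"
  proof
    fix g assume "g \<in> G"
    then show "g \<in> ?U" using alg_gen_superset[of "{g}"] by (auto intro!: exI[of _ "{g}"])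
  qed
  ultimately show ?thesis using alg_gen_least[of ?U G] assms by blast
qed

section \<open>The filtration compared with the powers of \<open>J 1\<close>\<close>

context ideal_filtration
begin

lemma subalgebra_rees: "subalgebra (rees J)"
  unfolding subalgebra_def
proof (intro conjI ballI allI)
  show "[:c:] \<in> rees J" for c
    by (auto simp: rees_def coeff_pCons is_ideal_zero split: nat.split)
qed (auto intro: rees_ideal_add[OF rees_ideal_rees] rees_ideal_mult[OF rees_ideal_rees])

text \<open>Each \<open>J n\<close> is spanned by products of generator coefficients of degrees in \<open>{1..\<delta>}\<close> with total
  degree \<open>n\<close>, and such a product has at least \<open>n / \<delta>\<close> factors. The hypothesis \<open>m * \<delta> < n + \<delta>\<close> says
  that \<open>m\<close> is at most this quotient rounded up; for \<open>\<delta> = 0\<close> it still says that \<open>n > 0\<close>.\<close>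

lemma filtration_le_ideal_pow:
  assumes gen: "alg_gen G = rees J" and hom: "\<And>g. g \<in> G \<Longrightarrow> homogeneous g"
    and deg: "\<And>g. g \<in> G \<Longrightarrow> degree g \<le> \<delta>" and mn: "m * \<delta> < n + \<delta>"
  shows "J n \<subseteq> ideal_pow (J 1) m"
proof -
  let ?S = "{p. \<forall>n m. m * \<delta> < n + \<delta> \<longrightarrow> coeff p n \<in> ideal_pow (J 1) m}"
  have "subalgebra ?S"
    unfolding subalgebra_def
  proof (intro conjI ballI allI)
    fix c show "[:c:] \<in> ?S"
      by (auto simp: coeff_pCons is_ideal_zero split: nat.split)
  next
    fix p q assume p: "p \<in> ?S" and q: "q \<in> ?S"
    show "p + q \<in> ?S" using p q by (auto intro: is_ideal_add)
    have "coeff p i * coeff q j \<in> ideal_pow (J 1) m" if m: "m * \<delta> < i + j + \<delta>" for m i j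
    proof (cases "\<delta> = 0")
      \<comment> \<open>For \<open>\<delta> = 0\<close> one factor has positive degree, and such
        coefficients lie in every power.\<close>
      case True
      then consider "0 < i" | "0 < j" using m by auto
      then show ?thesis
      proof cases
        case 1
        then show ?thesis using p True by (intro is_ideal_mult_right) auto
      next
        case 2
        then show ?thesis using q True by (intro is_ideal_mult) auto
      qed
    next
      case False
      \<comment> \<open>The quotients \<open>i / \<delta>\<close> and \<open>j / \<delta>\<close>
        rounded up: the largest exponents available for the two factors, with sum at least
        \<open>m\<close>.\<close>
      define k l where "k = (i + \<delta> - 1) div \<delta>" and "l = (j + \<delta> - 1) div \<delta>"
      have ceil: "(x + \<delta> - 1) div \<delta> * \<delta> < x + \<delta>" "x \<le> (x + \<delta> - 1) div \<delta> * \<delta>" for x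
        using div_mult_mod_eq[of "x + \<delta> - 1" \<delta>] mod_less_divisor[of \<delta> "x + \<delta> - 1"] False
        by linarith+
      have "m * \<delta> < (k + l + 1) * \<delta>"
        using m ceil(2)[of i] ceil(2)[of j] by (simp add: k_def l_def algebra_simps)
      then have "m < k + l + 1" by (rule mult_less_cancel2[THEN iffD1, THEN conjunct2])
      then have le: "m \<le> k + l" by simp
      have "coeff p i * coeff q j \<in> ideal_pow (J 1) (k + l)"
        using p q ceil(1)[of i] ceil(1)[of j] by (intro ideal_pow_mult_mem) (auto simp: k_def l_def)
      then show ?thesis using ideal_pow_anti[OF le] by blast
    qed
    then show "p * q \<in> ?S" by (auto simp: coeff_mult intro!: is_ideal_sum)
  qed
  moreover have "G \<subseteq> ?S"
  proof
    fix g assume g: "g \<in> G"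
    then obtain x d where gd: "g = monom x d" using hom unfolding homogeneous_def by blast
    have "g \<in> rees J" using g gen alg_gen_superset by blast
    then have x: "x \<in> J d" using gd by (auto simp: rees_def dest: spec[of _ d])
    show "g \<in> ?S"
    proof (cases "x = 0")
      case True
      then show ?thesis by (simp add: gd is_ideal_zero)
    next
      case False
      then have d: "d \<le> \<delta>" using deg[OF g] by (simp add: gd degree_monom_eq)
      have "x \<in> ideal_pow (J 1) m" if m: "m * \<delta> < d + \<delta>" for m
      proof -
        \<comment> \<open>A generator has degree at most \<open>\<delta>\<close>, so only the
          exponents 0 and 1 occur.\<close>
        have "m * \<delta> < 2 * \<delta>" using m d by linarith
        then have "m < 2" by (rule mult_less_cancel2[THEN iffD1, THEN conjunct2])
        moreover have "1 \<le> d" if "m \<noteq> 0" using m that by (cases m) auto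
        ultimately consider "m = 0" | "m = 1" "1 \<le> d" by linarith
        then show ?thesis
        proof cases
          case 2
          then show ?thesis using x J_anti[of 1 d] ideal_pow_one[of x "J 1"] by auto
        qed simp
      qed
      then show ?thesis by (auto simp: gd is_ideal_zero)
    qed
  qed
  ultimately have sub: "rees J \<subseteq> ?S" using alg_gen_least gen by blast
  show ?thesis
  proof
    fix x assume "x \<in> J n"
    then have "monom x n \<in> rees J" by (auto simp: rees_def is_ideal_zero)
    then have "coeff (monom x n) n \<in> ideal_pow (J 1) m" using sub mn by blast
    then show "x \<in> ideal_pow (J 1) m" by simp
  qed
qed

end

section \<open>Finite generation and the constants \<open>ar_num\<close> and
  \<open>rees_delta\<close>\<close>

locale noetherian_filtration = ideal_filtration J
  for J :: "nat \<Rightarrow> 'a::comm_ring_1 set" +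
  assumes noetherian: "noetherian_ring TYPE('a)"
    and local: "local_ring TYPE('a)"
    and J1: "J 1 \<noteq> UNIV"
    and noetherian_rees: "noetherian_rees J"
begin

lemma homogeneous_generators:
  assumes A: "rees_ideal J A" and closed: "\<And>p n. p \<in> A \<Longrightarrow> monom (coeff p n) n \<in> A"
  obtains H where "finite H" "\<And>h. h \<in> H \<Longrightarrow> homogeneous h" "rees_gen J H = A"
proof -
  obtain G where G: "finite G" "A = rees_gen J G"
    using noetherian_rees A unfolding noetherian_rees_def by blast
  have "G \<subseteq> A" using G rees_gen_superset by simp
  then have "G \<subseteq> rees J" using rees_ideal_subset[OF A] by blast
  moreover have "monom (coeff g n) n \<in> rees_gen J G" if "g \<in> G" for g n
    using closed that \<open>G \<subseteq> A\<close> G by blast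
  ultimately show ?thesis using rees_gen_homogeneous_generators[OF G(1)] that G(2) by metis
qed

text \<open>The minimal generating set selected in \<open>ar_num\<close> exists by finite generation
  and is finite by minimality, so all its degrees are at most \<open>ar_num J I\<close>.\<close>

lemma ar_bound_ar_num:
  assumes I: "is_ideal I"
  shows "ar_bound J I (ar_num J I)"
proof -
  let ?A = "rees_part J I"
  have A: "rees_ideal J ?A" by (rule rees_ideal_rees_part[OF I])
  obtain H where H: "finite H" "\<And>h. h \<in> H \<Longrightarrow> homogeneous h" "rees_gen J H = ?A"
    by (rule homogeneous_generators[OF A])
      (auto simp: rees_part_def is_ideal_zero I)
  obtain G0 where "G0 \<subseteq> H" "rees_gen J G0 = ?A" "\<And>H. H \<subset> G0 \<Longrightarrow> rees_gen J H \<noteq> ?A"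
    using minimal_generating_subset[of H "rees_gen J" ?A] H by metis
  then have "min_hom_ideal_gen J ?A G0"
    unfolding min_hom_ideal_gen_def using H(2) rees_gen_superset[of G0] by blast
  then have "\<exists>d G. min_hom_ideal_gen J ?A G \<and> d = max_gen_deg G" by blast
  then have "\<exists>G. min_hom_ideal_gen J ?A G \<and> ar_num J I = max_gen_deg G"
    unfolding ar_num_def by (rule someI_ex)
  then obtain G where G: "min_hom_ideal_gen J ?A G" "ar_num J I = max_gen_deg G" by blast
  have gen: "rees_gen J G = ?A" and sub: "G \<subseteq> ?A" and hom: "\<And>g. g \<in> G \<Longrightarrow> homogeneous g"
    and minimal: "\<And>H. H \<subset> G \<Longrightarrow> rees_gen J H \<noteq> rees_gen J G"
    using G(1) unfolding min_hom_ideal_gen_def by auto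
  have "G \<subseteq> rees J" using sub rees_ideal_subset[OF A] by blast
  then have "finite G"
    using finite_minimal_generating_set[of "rees_gen J" G H, OF rees_gen_superset rees_gen_idem
        rees_gen_finitary H(1) _ minimal] H(3) gen by simp
  then show ?thesis
    using ar_bound_of_generators[OF I gen hom] degree_le_max_gen_deg G(2) by auto
qed

text \<open>Homogeneous generators of the irrelevant ideal, the part of positive degree, generate
  the Rees algebra, by induction on the degree of a monomial.\<close>

lemma finite_alg_generators:
  obtains G where "finite G" "\<And>g. g \<in> G \<Longrightarrow> homogeneous g" "alg_gen G = rees J"
proof -
  define B where "B n = (if n = 0 then {0} else J n)" for n
  let ?A = "{p. \<forall>n. coeff p n \<in> B n}"
  have B: "is_ideal (B n)" for n
    unfolding B_def using is_ideal_J[of n] by (simp add: is_ideal_def)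
  have A: "rees_ideal J ?A"
  proof (rule rees_ideal_graded)
    show "is_ideal (B n)" for n by (rule B)
    show "B n \<subseteq> J n" for n by (auto simp: B_def)
    show "x * y \<in> B (m + n)" if "x \<in> J m" "y \<in> B n" for m n x y
      using that J_mult[of x m y n] by (auto simp: B_def is_ideal_zero split: if_splits)
  qed
  obtain G where G: "finite G" "\<And>g. g \<in> G \<Longrightarrow> homogeneous g" "rees_gen J G = ?A"
    by (rule homogeneous_generators[OF A]) (auto simp: is_ideal_zero[OF B])
  have GA: "G \<subseteq> ?A" using G rees_gen_superset by blast
  have Grees: "G \<subseteq> rees J" using GA rees_ideal_subset[OF A] by blast
  have monom: "monom x n \<in> alg_gen G" if "x \<in> J n" for x n
    using that
  proof (induction n arbitrary: x rule: less_induct)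
    case (less n)
    show ?case
    proof (cases "n = 0")
      case True
      then show ?thesis using subalgebra_const[OF subalgebra_alg_gen, of x G] by (simp add: monom_0)
    next
      case False
      \<comment> \<open>Closed under multiplication by \<open>s\<close>: as \<open>p\<close> has no
        constant term, every nonzero contribution in degree \<open>k \<le> n\<close> takes from
        \<open>s\<close> a coefficient of degree below \<open>n\<close>, to which the induction
        hypothesis applies.\<close>
      let ?C = "{p \<in> ?A. \<forall>k\<le>n. monom (coeff p k) k \<in> alg_gen G}"
      have "rees_ideal J ?C"
        unfolding rees_ideal_def
      proof (intro conjI ballI)
        show "?C \<subseteq> rees J" using rees_ideal_subset[OF A] by blast
        show "0 \<in> ?C"
          using rees_ideal_zero[OF A] subalgebra_const[OF subalgebra_alg_gen, of 0 G] by simp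
      next
        fix p q assume p: "p \<in> ?C" "q \<in> ?C"
        then show "p + q \<in> ?C"
          using rees_ideal_add[OF A, of p q]
          by (auto simp flip: add_monom intro: subalgebra_add[OF subalgebra_alg_gen])
      next
        fix s p assume s: "s \<in> rees J" and p: "p \<in> ?C"
        have "monom (coeff s i * coeff p (k - i)) k \<in> alg_gen G" if k: "k \<le> n" "i \<le> k" for k i
        proof (cases "i = k")
          case True
          then have "coeff p (k - i) = 0" using p by (auto simp: B_def dest: spec[of _ 0])
          then show ?thesis using subalgebra_const[OF subalgebra_alg_gen, of 0 G] by simp
        next
          case False
          then have "monom (coeff s i) i * monom (coeff p (k - i)) (k - i) \<in> alg_gen G"
            using less.IH[of i "coeff s i"] s p k
            by (intro subalgebra_mult[OF subalgebra_alg_gen]) (auto simp: rees_def)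
          then show ?thesis using k by (simp add: mult_monom)
        qed
        then have "(\<Sum>i\<le>k. monom (coeff s i * coeff p (k - i)) k) \<in> alg_gen G" if "k \<le> n" for k
          using that by (intro subalgebra_sum[OF subalgebra_alg_gen]) auto
        then show "s * p \<in> ?C"
          using rees_ideal_mult[OF A s] p by (auto simp: coeff_mult monom_sum)
      qed
      moreover have "G \<subseteq> ?C"
      proof
        fix g assume g: "g \<in> G"
        then obtain y d where gd: "g = monom y d" using G(2) unfolding homogeneous_def by blast
        then have "monom (coeff g k) k \<in> alg_gen G" for k
          using g alg_gen_superset[of G] subalgebra_const[OF subalgebra_alg_gen, of 0 G]
          by (cases "d = k") auto
        then show "g \<in> ?C" using g GA by blast
      qed
      ultimately have "?A \<subseteq> ?C" using rees_gen_least[of ?C G] G(3) by simp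
      moreover have "monom x n \<in> ?A" using less.prems False by (auto simp: B_def is_ideal_zero)
      ultimately have "monom (coeff (monom x n) n) n \<in> alg_gen G" by blast
      then show ?thesis by simp
    qed
  qed
  have "alg_gen G = rees J"
  proof
    show "alg_gen G \<subseteq> rees J" by (rule alg_gen_least[OF subalgebra_rees Grees])
    show "rees J \<subseteq> alg_gen G"
    proof
      fix p assume "p \<in> rees J"
      then have "(\<Sum>n\<le>degree p. monom (coeff p n) n) \<in> alg_gen G"
        by (intro subalgebra_sum[OF subalgebra_alg_gen] monom) (auto simp: rees_def)
      then show "p \<in> alg_gen G" by (simp add: poly_as_sum_of_monoms)
    qed
  qed
  with G that show ?thesis by blast
qed

lemma filtration_le_ideal_pow_rees_delta:
  assumes "m * rees_delta J < n + rees_delta J"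
  shows "J n \<subseteq> ideal_pow (J 1) m"
proof -
  obtain H where H: "finite H" "\<And>h. h \<in> H \<Longrightarrow> homogeneous h" "alg_gen H = rees J"
    using finite_alg_generators by metis
  obtain G0 where "G0 \<subseteq> H" "alg_gen G0 = rees J" "\<And>H. H \<subset> G0 \<Longrightarrow> alg_gen H \<noteq> rees J"
    using minimal_generating_subset[of H alg_gen "rees J"] H by metis
  then have "min_hom_alg_gen J G0"
    unfolding min_hom_alg_gen_def using H(2) alg_gen_superset[of G0] by blast
  then have "\<exists>d G. min_hom_alg_gen J G \<and> d = max_gen_deg G" by blast
  then have "\<exists>G. min_hom_alg_gen J G \<and> rees_delta J = max_gen_deg G"
    unfolding rees_delta_def by (rule someI_ex)
  then obtain G where G: "min_hom_alg_gen J G" "rees_delta J = max_gen_deg G" by blast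
  have gen: "alg_gen G = rees J" and hom: "\<And>g. g \<in> G \<Longrightarrow> homogeneous g"
    and minimal: "\<And>H. H \<subset> G \<Longrightarrow> alg_gen H \<noteq> alg_gen G"
    using G(1) unfolding min_hom_alg_gen_def by auto
  have "finite G"
    using finite_minimal_generating_set[of alg_gen G H, OF alg_gen_superset alg_gen_idem
        alg_gen_finitary H(1) _ minimal] H(3) gen by simp
  then show ?thesis
    using filtration_le_ideal_pow[OF gen hom _ assms] degree_le_max_gen_deg G(2) by auto
qed


section \<open>Stability under perturbation\<close>

text \<open>The elements that lie in every \<open>J m + L\<close> form an ideal \<open>?W\<close>.
  An Artin--Rees bound \<open>c\<close> for it shows that its part in \<open>J (Suc c)\<close> lies
  in the product of \<open>J 1\<close> and \<open>?W\<close>, and Nakayama's lemma applies.\<close>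

lemma krull_intersection:
  assumes L: "is_ideal L" and x: "\<And>m. x \<in> ideal_sum (J m) L"
  shows "x \<in> L"
proof -
  let ?W = "{x. \<forall>m. x \<in> ideal_sum (J m) L}"
  have W: "is_ideal ?W"
    using is_ideal_ideal_sum[OF is_ideal_J L] unfolding is_ideal_def by blast
  have LW: "L \<subseteq> ?W" using ideal_sum_right[OF is_ideal_J] by blast
  obtain c where c: "ar_bound J ?W c" using ar_bound_ar_num[OF W] by blast
  have "?W \<subseteq> ideal_sum L (ideal_prod (J 1) ?W)"
  proof
    fix w assume w: "w \<in> ?W"
    then obtain y where y: "y \<in> J (Suc c)" "w - y \<in> L" by (blast elim: ideal_sumE)
    then have "y \<in> ?W" using is_ideal_diff_iff[OF W] w LW by blast
    then have "y \<in> ar_span J ?W c (Suc c)" using y c unfolding ar_bound_def by blast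
    also have "ar_span J ?W c (Suc c) \<subseteq> ideal_prod (J 1) ?W"
    proof (rule ar_span_least)
      fix u v d assume "d \<le> c" "u \<in> J (Suc c - d)" "v \<in> ?W"
      moreover have "J (Suc c - d) \<subseteq> J 1" using \<open>d \<le> c\<close> by (intro J_anti) simp
      ultimately show "u * v \<in> ideal_prod (J 1) ?W" by (intro ideal_prodI) auto
    qed simp
    finally have "w - (w - y) \<in> ideal_prod (J 1) ?W" by simp
    then show "w \<in> ideal_sum L (ideal_prod (J 1) ?W)" using y(2) by (intro ideal_sumI)
  qed
  then have "?W \<subseteq> L" by (rule nakayama[OF noetherian local is_ideal_J J1 W L])
  with x show ?thesis by blast
qed

section \<open>Perturbing one generator over a fixed base ideal\<close>

context
  fixes Q f \<epsilon> b c
  assumes Q: "is_ideal Q"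
    and bound: "ar_bound J (adjoin Q f) c"
    and kill: "kills (J 1) b (colon Q f) Q"
    and \<epsilon>: "\<epsilon> \<in> J (Suc c)" "\<epsilon> \<in> ideal_pow (J 1) b"
begin

text \<open>The coefficient of \<open>f + \<epsilon>\<close> can be pushed to ever higher filtration degree: if it lies in \<open>J m\<close>,
  then the Artin--Rees bound puts it into \<open>J (Suc m)\<close> up to an element of \<open>Q : f\<close>, whose product
  with \<open>f + \<epsilon>\<close> is in \<open>Q\<close>.\<close>

lemma perturbed_coefficient:
  assumes x: "x \<in> J n" "x - h * (f + \<epsilon>) \<in> Q" and "m \<le> n - c"
  shows "\<exists>h'\<in>J m. x - h' * (f + \<epsilon>) \<in> Q \<and> h - h' \<in> colon Q f"
  using \<open>m \<le> n - c\<close>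
proof (induction m)
  case 0
  then show ?case using x by (auto intro!: bexI[of _ h] simp: colon_def is_ideal_zero[OF Q])
next
  case (Suc m)
  then obtain h' where h': "h' \<in> J m" "x - h' * (f + \<epsilon>) \<in> Q" "h - h' \<in> colon Q f" by auto
  have "h' * \<epsilon> \<in> J (m + Suc c)" using J_mult[OF h'(1) \<epsilon>(1)] .
  moreover have "m + Suc c \<le> n" using Suc.prems by linarith
  then have "x \<in> J (m + Suc c)" using x(1) J_anti by blast
  ultimately have "x - h' * \<epsilon> \<in> J (m + Suc c)" by (intro is_ideal_diff) auto
  moreover have "x - h' * \<epsilon> \<in> adjoin Q f"
    using h'(2) by (intro adjoinI[where h = h']) (simp add: algebra_simps)
  ultimately have "x - h' * \<epsilon> \<in> ar_span J (adjoin Q f) c (m + Suc c)"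
    using bound unfolding ar_bound_def by blast
  also have "\<dots> \<subseteq> {y. \<exists>k\<in>J (Suc m). y - k * f \<in> Q}"
  proof (rule ar_span_least)
    fix u v d assume d: "d \<le> c" and u: "u \<in> J (m + Suc c - d)" and v: "v \<in> adjoin Q f"
    obtain k where k: "v - k * f \<in> Q" using v by (rule adjoinE)
    \<comment> \<open>The gain of one degree: \<open>m + Suc c - d\<close> is at least
      \<open>Suc m\<close> because \<open>d \<le> c\<close>.\<close>
    have "u \<in> J (Suc m)" by (rule subsetD[OF J_anti u]) (use d in simp)
    then have "u * k \<in> J (Suc m)" by (intro is_ideal_mult_right) auto
    moreover have "u * v - (u * k) * f \<in> Q"
      using is_ideal_mult[OF Q k, of u] by (simp add: algebra_simps)
    ultimately show "u * v \<in> {y. \<exists>k\<in>J (Suc m). y - k * f \<in> Q}" by blast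
  qed (rule is_ideal_adjoin_coeff[OF Q is_ideal_J])
  finally obtain k where k: "k \<in> J (Suc m)" "x - h' * \<epsilon> - k * f \<in> Q" by blast
  have "(x - h' * \<epsilon> - k * f) - (x - h' * (f + \<epsilon>)) \<in> Q"
    by (rule is_ideal_diff[OF Q k(2) h'(2)])
  then have s: "h' - k \<in> colon Q f" by (simp add: colon_def algebra_simps)
  have "\<epsilon> * (h' - k) \<in> Q" using killsD[OF kill \<epsilon>(2) s] .
  then have "(x - h' * \<epsilon> - k * f) + \<epsilon> * (h' - k) \<in> Q" using k Q by (intro is_ideal_add)
  then have "x - k * (f + \<epsilon>) \<in> Q" by (simp add: algebra_simps)
  moreover have "h - k \<in> colon Q f"
    using is_ideal_add[OF is_ideal_colon[OF Q] h'(3) s] by simp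
  ultimately show ?case using k(1) by blast
qed

text \<open>Such an \<open>h\<close> is a coefficient of the element 0, which lies in every
  \<open>J n\<close>. So \<open>h\<close> lies in \<open>J m + (Q : f)\<close> for every
  \<open>m\<close>, and the intersection theorem applies.\<close>

lemma colon_perturbed: "colon Q (f + \<epsilon>) \<subseteq> colon Q f"
proof
  fix h assume h: "h \<in> colon Q (f + \<epsilon>)"
  show "h \<in> colon Q f"
  proof (rule krull_intersection[OF is_ideal_colon[OF Q]])
    fix m
    have "0 \<in> J (m + c)" "0 - h * (f + \<epsilon>) \<in> Q"
      using is_ideal_uminus[OF Q, of "h * (f + \<epsilon>)"] h by (auto simp: colon_def is_ideal_zero)
    then show "h \<in> ideal_sum (J m) (colon Q f)"
      using perturbed_coefficient[of 0 "m + c" h m] by (auto intro: ideal_sumI)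
  qed
qed

text \<open>Forward, replacing \<open>f\<close> by \<open>f + \<epsilon>\<close> alters generators
  of degree at most \<open>c\<close> by elements of \<open>J (Suc c)\<close>. Backward, the
  coefficient of \<open>f + \<epsilon>\<close> can be taken in \<open>J (n - c)\<close>; its product
  with \<open>\<epsilon>\<close> lies in \<open>J (Suc n)\<close>, also when \<open>n < c\<close>
  and the difference is truncated to 0.\<close>

lemma initially_below_perturbed:
  "initially_below J (adjoin Q f) (adjoin Q (f + \<epsilon>))"
  "initially_below J (adjoin Q (f + \<epsilon>)) (adjoin Q f)"
proof -
  have adj: "is_ideal (adjoin Q g)" for g by (rule is_ideal_adjoin[OF Q])
  show "initially_below J (adjoin Q f) (adjoin Q (f + \<epsilon>))"
    unfolding initially_below_def
  proof
    fix n
    have "ar_span J (adjoin Q f) c n \<subseteq> ideal_sum (adjoin Q (f + \<epsilon>)) (J (Suc n))"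
    proof (rule ar_span_least)
      fix u v d assume d: "d \<le> c" "d \<le> n" and u: "u \<in> J (n - d)" and v: "v \<in> adjoin Q f"
      obtain k where k: "v - k * f \<in> Q" using v by (rule adjoinE)
      have "u * (v + k * \<epsilon>) \<in> adjoin Q (f + \<epsilon>)"
        using k by (intro is_ideal_mult[OF adj] adjoinI[where h = k]) (simp add: algebra_simps)
      moreover have "u * (k * \<epsilon>) \<in> J (Suc n)"
        using J_mult_diff[OF u is_ideal_mult[OF is_ideal_J \<epsilon>(1)]] d by simp
      then have "u * v - u * (v + k * \<epsilon>) \<in> J (Suc n)"
        using is_ideal_uminus[OF is_ideal_J] by (fastforce simp: algebra_simps)
      ultimately show "u * v \<in> ideal_sum (adjoin Q (f + \<epsilon>)) (J (Suc n))" by (rule ideal_sumI)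
    qed (simp add: is_ideal_ideal_sum adj)
    then show "J n \<inter> adjoin Q f \<subseteq> ideal_sum (adjoin Q (f + \<epsilon>)) (J (Suc n))"
      using bound unfolding ar_bound_def by blast
  qed
  show "initially_below J (adjoin Q (f + \<epsilon>)) (adjoin Q f)"
    unfolding initially_below_def
  proof (intro allI subsetI)
    fix n x assume x: "x \<in> J n \<inter> adjoin Q (f + \<epsilon>)"
    then obtain h where "x - h * (f + \<epsilon>) \<in> Q" by (blast elim: adjoinE)
    then obtain k where k: "k \<in> J (n - c)" "x - k * (f + \<epsilon>) \<in> Q"
      using perturbed_coefficient[of x n h "n - c"] x by blast
    have "x - k * \<epsilon> \<in> adjoin Q f"
      using k(2) by (intro adjoinI[where h = k]) (simp add: algebra_simps)
    moreover have "x - (x - k * \<epsilon>) \<in> J (Suc n)"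
      using subsetD[OF J_anti J_mult[OF k(1) \<epsilon>(1)], of "Suc n"] by simp
    ultimately show "x \<in> ideal_sum (adjoin Q f) (J (Suc n))" by (rule ideal_sumI)
  qed
qed

end

text \<open>The invariant of the successive perturbations: \<open>a\<close> and \<open>c\<close>
  stay fixed as upper bounds while the elements of the sequence change.\<close>

definition tame_sequence :: "(nat \<Rightarrow> nat) \<Rightarrow> nat \<Rightarrow> (nat \<Rightarrow> 'a) \<Rightarrow> nat \<Rightarrow> bool" where
  "tame_sequence a c g r \<longleftrightarrow>
     (\<forall>k<r. kills (J 1) (a k) (colon (gen_ideal (g ` {..<k})) (g k)) (gen_ideal (g ` {..<k}))) \<and>
     (\<forall>k<r. ar_bound J (gen_ideal (g ` {..<Suc k})) c)"

text \<open>The first condition on \<open>T\<close> makes \<open>\<epsilon>\<close> annihilate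
  \<open>(Q k : g j)/Q k\<close> for every base \<open>Q k\<close> with
  \<open>j < k \<le> r\<close>. The second supplies the larger power by which a later exponent
  \<open>a k\<close> survives the change of its base ideal.\<close>

lemma tame_sequence_perturb_one:
  assumes tame: "tame_sequence a c g r" and j: "j < r"
    and T: "(\<Sum>i<r. a i) \<le> T" "\<And>k. 0 < k \<Longrightarrow> k < r \<Longrightarrow> (\<Sum>i<k. a i) + 2 * a k \<le> T"
    and \<epsilon>: "\<epsilon> \<in> J (Suc c)" "\<epsilon> \<in> ideal_pow (J 1) (Suc T)"
  defines "g' \<equiv> g(j := g j + \<epsilon>)"
  shows "tame_sequence a c g' r"
    and "in_F J (gen_ideal (g' ` {..<r})) = in_F J (gen_ideal (g ` {..<r}))"
proof -
  define I where "I k = gen_ideal (g ` {..<k})" for k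
  define I' where "I' k = gen_ideal (g' ` {..<k})" for k
  \<comment> \<open>The generators other than the perturbed one, common to the old and the new
    ideal.\<close>
  define Q where "Q k = gen_ideal (g ` ({..<k} - {j}))" for k
  have killI: "kills (J 1) (a k) (colon (I k) (g k)) (I k)" if "k < r" for k
    using tame that by (auto simp: tame_sequence_def I_def)
  have boundI: "ar_bound J (I k) c" if "k \<le> r" "0 < k" for k
    using tame that by (cases k) (auto simp: tame_sequence_def I_def)
  have Q: "is_ideal (Q k)" for k by (simp add: Q_def)
  have I_adj: "I k = adjoin (Q k) (g j)" and I'_adj: "I' k = adjoin (Q k) (g j + \<epsilon>)"
    if "j < k" for k
  proof -
    have "g ` {..<k} = insert (g j) (g ` ({..<k} - {j}))"
      and "g' ` {..<k} = insert (g j + \<epsilon>) (g ` ({..<k} - {j}))"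
      using that by (auto simp: g'_def)
    then show "I k = adjoin (Q k) (g j)" "I' k = adjoin (Q k) (g j + \<epsilon>)"
      by (simp_all add: I_def I'_def Q_def gen_ideal_insert)
  qed
  have I_le: "I k = Q k" and I'_le: "I' k = Q k" if "k \<le> j" for k
  proof -
    have "{..<k} - {j} = {..<k}" and "g' ` {..<k} = g ` {..<k}"
      using that by (auto simp: g'_def)
    then show "I k = Q k" "I' k = Q k" by (simp_all add: I_def I'_def Q_def)
  qed
  have Q_Suc: "Q (Suc k) = adjoin (Q k) (g k)" if "k \<noteq> j" for k
  proof -
    have "{..<Suc k} - {j} = insert k ({..<k} - {j})" using that by auto
    then show ?thesis by (simp add: Q_def gen_ideal_insert)
  qed
  have Q_Suc_j: "Q (Suc j) = Q j"
    by (simp add: Q_def lessThan_Suc)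

  \<comment> \<open>Starting from \<open>a j\<close>, the exchange lemma adds \<open>a k\<close>
    each time \<open>g k\<close> joins the base.\<close>
  have killQ: "kills (J 1) (\<Sum>i\<in>{j..<k}. a i) (colon (Q k) (g j)) (Q k)" if "j < k" "k \<le> r" for k
  proof -
    have "Suc j \<le> k" using that by simp
    then show ?thesis using \<open>k \<le> r\<close>
    proof (induction rule: dec_induct)
      case base
      then show ?case using killI[OF j] I_le[of j] Q_Suc_j by simp
    next
      case (step k)
      then have "kills (J 1) (a k) (colon (adjoin (Q k) (g j)) (g k)) (adjoin (Q k) (g j))"
        using killI[of k] I_adj[of k] by simp
      from kills_colon_swap[OF Q _ this] step show ?case
        by (simp add: Q_Suc sum.atLeastLessThan_Suc)
    qed
  qed
  have sum_le: "(\<Sum>i\<in>{j..<k}. a i) \<le> (\<Sum>i<k. a i)" for k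
    by (rule sum_mono2) auto
  have \<epsilon>_pow: "\<epsilon> \<in> ideal_pow (J 1) m" if "m \<le> Suc T" for m
    using \<epsilon>(2) ideal_pow_anti[OF that] by blast
  have \<epsilon>Q: "\<epsilon> \<in> ideal_pow (J 1) (\<Sum>i\<in>{j..<k}. a i)" if "j < k" "k \<le> r" for k
  proof -
    have "(\<Sum>i<k. a i) \<le> (\<Sum>i<r. a i)" using that by (intro sum_mono2) auto
    then show ?thesis using sum_le[of k] T(1) by (intro \<epsilon>_pow) simp
  qed
  have boundQ: "ar_bound J (adjoin (Q k) (g j)) c" if "j < k" "k \<le> r" for k
    using boundI[of k] I_adj[of k] that by simp

  have below: "initially_below J (I k) (I' k)" "initially_below J (I' k) (I k)"
    if k: "j < k" "k \<le> r" for k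
    using initially_below_perturbed[OF Q boundQ[OF k] killQ[OF k] \<epsilon>(1) \<epsilon>Q[OF k]] k
    by (simp_all add: I_adj I'_adj)
  have bound': "ar_bound J (I' k) c" if k: "k \<le> r" "0 < k" for k
  proof (cases "j < k")
    case True
    have I': "is_ideal (I' k)" by (simp add: I'_def)
    \<comment> \<open>The Artin--Rees number of the perturbed ideal serves as the auxiliary finite
      bound of the transfer, which returns the original \<open>c\<close>.\<close>
    show ?thesis
      using ar_bound_transfer[OF I' boundI[OF k] below[OF True k(1)] ar_bound_ar_num[OF I']] .
  next
    case False
    then show ?thesis using boundI[OF k] I_le[of k] I'_le[of k] by simp
  qed
  have kill': "kills (J 1) (a k) (colon (I' k) (g' k)) (I' k)" if k: "k < r" for k
  proof -
    consider "k < j" | "k = j" | "j < k" by linarith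
    then show ?thesis
    proof cases
      case 1
      then show ?thesis using killI[OF k] I_le[of k] I'_le[of k] by (simp add: g'_def)
    next
      case 2
      \<comment> \<open>For \<open>k = j\<close> the base ideal is unchanged and the colon ideal can
        only shrink.\<close>
      have "kills (J 1) (a j) (colon (Q j) (g j)) (Q j)" using killI[OF j] I_le[of j] by simp
      moreover have "colon (Q j) (g j + \<epsilon>) \<subseteq> colon (Q j) (g j)"
        unfolding Q_Suc_j[symmetric] using j
        by (intro colon_perturbed[OF Q boundQ killQ \<epsilon>(1) \<epsilon>Q]) auto
      ultimately show ?thesis
        using 2 I'_le[of j] by (auto simp: g'_def intro: kills_mono)
    next
      case 3
      let ?c = "\<Sum>i\<in>{j..<k}. a i"
      have "colon (Q (Suc k)) (g j + \<epsilon>) \<subseteq> colon (Q (Suc k)) (g j)"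
        using 3 k by (intro colon_perturbed[OF Q boundQ killQ \<epsilon>(1) \<epsilon>Q]) auto
      then have colon_sub: "colon (adjoin (Q k) (g k)) (g j + \<epsilon>) \<subseteq> colon (adjoin (Q k) (g k)) (g j)"
        using 3 by (simp add: Q_Suc)
      have "Suc (a k) + (?c + a k) \<le> Suc T" using sum_le[of k] T(2)[OF _ k] 3 by simp
      then have e: "\<epsilon> \<in> ideal_pow (J 1) (Suc (a k) + (?c + a k))" by (rule \<epsilon>_pow)
      have "kills (J 1) (a k) (colon (adjoin (Q k) (g j)) (g k)) (adjoin (Q k) (g j))"
        using killI[OF k] I_adj[OF 3] by simp
      from kills_colon_perturb_base[OF noetherian local is_ideal_J J1 Q killQ this colon_sub e]
      show ?thesis using 3 k by (simp add: I'_adj g'_def)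
    qed
  qed
  show "tame_sequence a c g' r"
    using kill' bound' by (auto simp: tame_sequence_def I'_def)
  show "in_F J (gen_ideal (g' ` {..<r})) = in_F J (gen_ideal (g ` {..<r}))"
    using in_F_mono[OF below(1)[OF j order_refl]] in_F_mono[OF below(2)[OF j order_refl]]
    by (simp add: I_def I'_def)
qed

text \<open>Passes through the sequences whose first \<open>t\<close> elements are perturbed; since
  \<open>a\<close> and \<open>c\<close> persist, the same conditions on \<open>\<epsilon>\<close>
  serve every step.\<close>

lemma tame_sequence_perturb:
  assumes tame: "tame_sequence a c f r"
    and T: "(\<Sum>i<r. a i) \<le> T" "\<And>k. 0 < k \<Longrightarrow> k < r \<Longrightarrow> (\<Sum>i<k. a i) + 2 * a k \<le> T"
    and \<epsilon>: "\<And>i. i < r \<Longrightarrow> \<epsilon> i \<in> J (Suc c) \<and> \<epsilon> i \<in> ideal_pow (J 1) (Suc T)"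
  shows "tame_sequence a c (\<lambda>i. f i + \<epsilon> i) r \<and>
    in_F J (gen_ideal ((\<lambda>i. f i + \<epsilon> i) ` {..<r})) = in_F J (gen_ideal (f ` {..<r}))"
proof -
  define g where "g t = (\<lambda>i. if i < t then f i + \<epsilon> i else f i)" for t
  have main: "tame_sequence a c (g t) r \<and>
      in_F J (gen_ideal (g t ` {..<r})) = in_F J (gen_ideal (f ` {..<r}))" if "t \<le> r" for t
    using that
  proof (induction t)
    case 0
    then show ?case using tame by (simp add: g_def)
  next
    case (Suc t)
    have g_Suc: "g (Suc t) = (g t)(t := g t t + \<epsilon> t)" by (auto simp: g_def)
    have tame_t: "tame_sequence a c (g t) r" and t: "t < r" using Suc by auto
    have "\<epsilon> t \<in> J (Suc c)" "\<epsilon> t \<in> ideal_pow (J 1) (Suc T)" using \<epsilon>[OF t] by blast+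
    from tame_sequence_perturb_one[OF tame_t t T this]
    have "tame_sequence a c (g (Suc t)) r"
      "in_F J (gen_ideal (g (Suc t) ` {..<r})) = in_F J (gen_ideal (g t ` {..<r}))"
      by (simp_all only: g_Suc)
    with Suc show ?case by simp
  qed
  have g_eq: "g r ` {..<k} = (\<lambda>i. f i + \<epsilon> i) ` {..<k}" if "k \<le> r" for k
    using that by (auto simp: g_def)
  have "tame_sequence a c (\<lambda>i. f i + \<epsilon> i) r"
    using main[of r] unfolding tame_sequence_def by (simp add: g_eq) (simp add: g_def)
  then show ?thesis using main[of r] g_eq[of r] by simp
qed

end

theorem theorem5p6:
  fixes J :: "nat \<Rightarrow> 'a::comm_ring_1 set" and f \<epsilon> :: "nat \<Rightarrow> 'a" and r N :: nat
  assumes "noetherian_ring TYPE('a)" and "local_ring TYPE('a)"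
    and "filtration J" and "J 1 \<noteq> UNIV" and "noetherian_rees J"
    and "filter_regular (J 1) f r"
    and "N = Max (insert
            (((\<Sum>i<r. 2 ^ i * a_index (J 1) (colon (gen_ideal (f ` {..<i})) (f i))
                                   (gen_ideal (f ` {..<i}))) + 1) * rees_delta J)
            {ar_num J (gen_ideal (f ` {..<i})) + 1 | i. 1 \<le> i \<and> i \<le> r})"
    and "\<forall>i<r. \<epsilon> i \<in> J N"
  shows "filter_regular (J 1) (\<lambda>i. f i + \<epsilon> i) r
       \<and> in_F J (gen_ideal ((\<lambda>i. f i + \<epsilon> i) ` {..<r})) = in_F J (gen_ideal (f ` {..<r}))"
proof (cases "r = 0")
  case True
  \<comment> \<open>Separated because \<open>N\<close> may be 0 when no Artin--Rees number enters
    the maximum.\<close>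
  then show ?thesis by (simp add: filter_regular_def)
next
  case False
  interpret noetherian_filtration J
    by unfold_locales (use assms in auto)
  define a where
    "a k = a_index (J 1) (colon (gen_ideal (f ` {..<k})) (f k)) (gen_ideal (f ` {..<k}))" for k
  define T where "T = (\<Sum>i<r. 2 ^ i * a i)"
  define S where "S = insert ((T + 1) * rees_delta J)
    {ar_num J (gen_ideal (f ` {..<i})) + 1 | i. 1 \<le> i \<and> i \<le> r}"
  have "finite S" unfolding S_def by simp
  have N: "N = Max S" unfolding S_def T_def a_def by (rule assms(7))
  have N_ge: "s \<le> N" if "s \<in> S" for s using that \<open>finite S\<close> N by simp
  have N_delta: "(T + 1) * rees_delta J \<le> N" by (rule N_ge) (simp add: S_def)
  have N_ar: "ar_num J (gen_ideal (f ` {..<i})) + 1 \<le> N" if "1 \<le> i" "i \<le> r" for i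
    by (rule N_ge) (use that in \<open>auto simp: S_def\<close>)
  \<comment> \<open>This allows the bound \<open>c = N - 1\<close> with \<open>Suc c = N\<close>,
    even if \<open>rees_delta J = 0\<close>.\<close>
  have "0 < N" using N_ar[of r] False by simp

  have "kills (J 1) (a k) (colon (gen_ideal (f ` {..<k})) (f k)) (gen_ideal (f ` {..<k}))"
    if "k < r" for k
    using assms(6) that kills_a_index unfolding a_def filter_regular_iff_kills[OF noetherian is_ideal_J]
    by blast
  moreover have "ar_bound J (gen_ideal (f ` {..<Suc k})) (N - 1)" if "k < r" for k
    using ar_bound_mono[OF ar_bound_ar_num[OF is_ideal_gen_ideal]] N_ar[of "Suc k"] that by simp
  ultimately have tame: "tame_sequence a (N - 1) f r" by (simp add: tame_sequence_def)

  have T_ge: "(\<Sum>i<k. a i) + 2 * a k \<le> T" if "0 < k" "k < r" for k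
  proof -
    \<comment> \<open>With indices from 0, the weight of every element but the first is at least 2,
      which pays for \<open>2 * a k\<close>.\<close>
    have "(2::nat) \<le> 2 ^ k" using that power_increasing[of 1 k "2::nat"] by simp
    then have "2 * a k \<le> 2 ^ k * a k" by (rule mult_le_mono1)
    moreover have "(\<Sum>i<k. a i) \<le> (\<Sum>i<k. 2 ^ i * a i)" by (rule sum_mono) simp
    ultimately have "(\<Sum>i<k. a i) + 2 * a k \<le> (\<Sum>i<Suc k. 2 ^ i * a i)"
      unfolding sum.lessThan_Suc by (intro add_mono)
    also have "\<dots> \<le> T" unfolding T_def using that by (intro sum_mono2) auto
    finally show ?thesis .
  qed
  have "(\<Sum>i<r. a i) \<le> T" unfolding T_def by (rule sum_mono) simp
  \<comment> \<open>The strict inequality comes from the first entry of the maximum if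
    \<open>rees_delta J > 0\<close>, and from \<open>0 < N\<close> otherwise.\<close>
  moreover have "Suc T * rees_delta J < N + rees_delta J"
    using N_delta \<open>0 < N\<close> by (cases "rees_delta J = 0") auto
  then have "J N \<subseteq> ideal_pow (J 1) (Suc T)" by (rule filtration_le_ideal_pow_rees_delta)
  then have "\<epsilon> i \<in> J (Suc (N - 1)) \<and> \<epsilon> i \<in> ideal_pow (J 1) (Suc T)" if "i < r" for i
    using assms(8) that \<open>0 < N\<close> by auto
  ultimately have result: "tame_sequence a (N - 1) (\<lambda>i. f i + \<epsilon> i) r \<and>
      in_F J (gen_ideal ((\<lambda>i. f i + \<epsilon> i) ` {..<r})) = in_F J (gen_ideal (f ` {..<r}))"
    using tame_sequence_perturb[OF tame _ T_ge] by blast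
  then have "filter_regular (J 1) (\<lambda>i. f i + \<epsilon> i) r"
    unfolding tame_sequence_def filter_regular_iff_kills[OF noetherian is_ideal_J] by blast
  with result show ?thesis by blast
qed

end
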